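(* Let $d\ge3$ and let $V:(0,1)\to\mathbb{C}$ be measurable with $\int_0^1 r|V(r)|\,dr<\infty$. Let $m\in\mathbb{N}_0$ and $p\in\mathcal{H}_m(\mathbb{S}^{d-1})$, and let $U_m(x)=r^m\alpha_m(r)p(\xi)$, $x=r\xi$, $r=|x|$, $\xi\in\mathbb{S}^{d-1}$. For $0<\varepsilon<1$ let $A_\varepsilon(0)=\{x\in\mathbb{R}^d:\varepsilon<|x|<1\}$. Then $U_m\in W^{1,2}(\mathbb{B}^d)\cap W^{2,1}(A_\varepsilon(0))$ and $U_m$ satisfies $-\Delta U_m+V(|x|)U_m=0$ a.e. in $A_\varepsilon(0)$, for all $0<\varepsilon<1$. Therefore $U_m\in\operatorname{Sol}_V^w(\mathbb{B}^d)$.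
   Context: $\mathbb{B}^d$ and $\mathbb{S}^{d-1}$ are the open unit ball and unit sphere of $\mathbb{R}^d$; $\mathbb{N}_0=\{0,1,2,\dots\}$. $\mathcal{H}_m(\mathbb{S}^{d-1})$ is the space of spherical harmonics of degree $m$, i.e. restrictions to $\mathbb{S}^{d-1}$ of (complex) homogeneous harmonic polynomials of degree $m$ on $\mathbb{R}^d$. Radial functions: for $m\in\mathbb{N}_0$ put $\ell_m=m+\frac{d-3}{2}$ and let $y_m$ be the regular solution of $$-y_m''+\frac{\ell_m(\ell_m+1)}{r^2}y_m+V(r)y_m=0\ \text{ a.e. on }(0,1),\qquad y_m(r)\sim r^{\ell_m+1},\ \ y_m'(r)\sim(\ell_m+1)r^{\ell_m}\ (r\to0^+),$$ given explicitly by $y_m=\sum_{k\ge0}\psi_k$, $\psi_0(r)=r^{\ell_m+1}$, $\psi_k(r)=\int_0^r\frac{1}{2\ell_m+1}\left(\frac{r^{\ell_m+1}}{s^{\ell_m}}-\frac{s^{\ell_m+1}}{r^{\ell_m}}\right)V(s)\psi_{k-1}(s)\,ds$ for $k\ge1$. Define $\alpha_m(r)=y_m(r)/r^{\ell_m+1}$ for $r\in(0,1]$ and $\alpha_m(0)=1$. $\operatorname{Sol}_V^w(\mathbb{B}^d)$ is the space of weak solutions of $-\Delta u+V(|x|)u=0$: those $u\in W^{1,2}(\mathbb{B}^d)$ such that $\int_{\mathbb{B}^d}(\nabla u\cdot\nabla\varphi+V(|x|)u\varphi)\,dx=0$ for all $\varphi\in C_0^\infty(\mathbb{B}^d)$ (with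 $Vu\varphi$ integrable; $\nabla u\cdot\nabla\varphi=\sum_i\partial_iu\,\partial_i\varphi$). *)

theory Defs
  imports "HOL-Analysis.Analysis"
begin

section \<open>Partial derivatives and test functions\<close>

definition partial :: "'n::finite \<Rightarrow> (real^'n \<Rightarrow> complex) \<Rightarrow> real^'n \<Rightarrow> complex" where
  "partial i f x = frechet_derivative f (at x) (axis i 1)"

text \<open>Multi-indices are represented by lists of coordinate directions; the order of the derivative
  is the length of the list. Up to the order of differentiation, which does not matter for smooth
  functions, this is the usual multi-index notation.\<close>

definition partials :: "'n::finite list \<Rightarrow> (real^'n \<Rightarrow> complex) \<Rightarrow> real^'n \<Rightarrow> complex" where
  "partials js f = foldr partial js f"

definition smooth :: "(real^'n::finite \<Rightarrow> complex) \<Rightarrow> bool" where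
  "smooth f \<longleftrightarrow> (\<forall>js x. partials js f differentiable (at x))"

definition test_functions :: "(real^'n::finite) set \<Rightarrow> (real^'n \<Rightarrow> complex) set" where
  "test_functions \<Omega> =
    {\<phi>. smooth \<phi> \<and> compact (closure {x. \<phi> x \<noteq> 0}) \<and> closure {x. \<phi> x \<noteq> 0} \<subseteq> \<Omega>}"

section \<open>Sobolev spaces\<close>

text \<open>Members of the spaces below are functions on the whole space of which only the values in
  \<open>\<Omega>\<close> matter, and these only up to null sets.\<close>

definition Lp_space :: "real \<Rightarrow> (real^'n::finite) set \<Rightarrow> (real^'n \<Rightarrow> complex) set" where
  "Lp_space q \<Omega> = {f. f \<in> borel_measurable (lebesgue_on \<Omega>) \<and>
     integrable (lebesgue_on \<Omega>) (\<lambda>x. norm (f x) powr q)}"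

definition locally_integrable :: "(real^'n::finite) set \<Rightarrow> (real^'n \<Rightarrow> complex) \<Rightarrow> bool" where
  "locally_integrable \<Omega> f \<longleftrightarrow> (\<forall>K. compact K \<and> K \<subseteq> \<Omega> \<longrightarrow> integrable (lebesgue_on K) f)"

definition weak_deriv ::
  "(real^'n::finite) set \<Rightarrow> 'n list \<Rightarrow> (real^'n \<Rightarrow> complex) \<Rightarrow> (real^'n \<Rightarrow> complex) \<Rightarrow> bool" where
  "weak_deriv \<Omega> js u g \<longleftrightarrow> locally_integrable \<Omega> u \<and> locally_integrable \<Omega> g \<and>
     (\<forall>\<phi>\<in>test_functions \<Omega>.
        (LINT x|lebesgue_on \<Omega>. u x * partials js \<phi> x)
          = (-1) ^ length js * (LINT x|lebesgue_on \<Omega>. g x * \<phi> x))"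

definition Sobolev :: "nat \<Rightarrow> real \<Rightarrow> (real^'n::finite) set \<Rightarrow> (real^'n \<Rightarrow> complex) set" where
  "Sobolev k q \<Omega> = {u \<in> Lp_space q \<Omega>.
     \<forall>js. length js \<le> k \<longrightarrow> (\<exists>g\<in>Lp_space q \<Omega>. weak_deriv \<Omega> js u g)}"

definition weak_laplacian ::
  "(real^'n::finite) set \<Rightarrow> (real^'n \<Rightarrow> complex) \<Rightarrow> (real^'n \<Rightarrow> complex) \<Rightarrow> bool" where
  "weak_laplacian \<Omega> u w \<longleftrightarrow>
     (\<exists>g. (\<forall>i. weak_deriv \<Omega> [i, i] u (g i)) \<and> (\<forall>x. w x = (\<Sum>i\<in>UNIV. g i x)))"

text \<open>Weak derivatives are unique almost everywhere, so it does not matter which representative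
  \<open>G i\<close> of the \<open>i\<close>-th weak derivative is chosen. Integrability of the first summand of the
  integrand is automatic; that of the second one is part of the definition.\<close>

definition Sol_weak :: "(real \<Rightarrow> complex) \<Rightarrow> (real^'n::finite \<Rightarrow> complex) set" where
  "Sol_weak V = {u \<in> Sobolev 1 2 (ball 0 1).
     \<exists>G. (\<forall>i. weak_deriv (ball 0 1) [i] u (G i)) \<and>
       (\<forall>\<phi>\<in>test_functions (ball 0 1).
          integrable (lebesgue_on (ball 0 1)) (\<lambda>x. V (norm x) * u x * \<phi> x) \<and>
          (LINT x|lebesgue_on (ball 0 1).
             (\<Sum>i\<in>UNIV. G i x * partial i \<phi> x) + V (norm x) * u x * \<phi> x) = 0)}"

section \<open>Spherical harmonics\<close>

definition homogeneous_polynomial :: "nat \<Rightarrow> (real^'n::finite \<Rightarrow> complex) \<Rightarrow> bool" where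
  "homogeneous_polynomial m P \<longleftrightarrow>
     (\<exists>c. \<forall>x. P x = (\<Sum>a | (\<Sum>i\<in>UNIV. a i) = m. c a * (\<Prod>i\<in>UNIV. of_real (x $ i) ^ a i)))"

text \<open>The index set of the sum above is finite, so the sum does not degenerate to zero.\<close>

lemma finite_exponents: "finite {a :: 'n::finite \<Rightarrow> nat. (\<Sum>i\<in>UNIV. a i) = m}"
proof (rule finite_subset)
  show "{a :: 'n \<Rightarrow> nat. (\<Sum>i\<in>UNIV. a i) = m} \<subseteq> UNIV \<rightarrow>\<^sub>E {..m}"
    by (auto simp: PiE_UNIV_domain intro: member_le_sum)
qed (simp add: finite_PiE)

definition harmonic :: "(real^'n::finite \<Rightarrow> complex) \<Rightarrow> bool" where
  "harmonic P \<longleftrightarrow> (\<forall>x. (\<Sum>i\<in>UNIV. partials [i, i] P x) = 0)"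

text \<open>Functions on the sphere are represented by functions on the whole space whose values off
  the sphere are arbitrary. As \<open>harmonic\<close> is only applied to polynomials, the derivatives in it
  always exist.\<close>

definition spherical_harmonics :: "nat \<Rightarrow> (real^'n::finite \<Rightarrow> complex) set" where
  "spherical_harmonics m =
     {p. \<exists>P. homogeneous_polynomial m P \<and> harmonic P \<and> (\<forall>\<xi>\<in>sphere 0 1. p \<xi> = P \<xi>)}"

section \<open>The regular solution of the radial equation\<close>

definition ell :: "nat \<Rightarrow> nat \<Rightarrow> real" where
  "ell d m = real m + (real d - 3) / 2"

primrec psi :: "(real \<Rightarrow> complex) \<Rightarrow> real \<Rightarrow> nat \<Rightarrow> real \<Rightarrow> complex" where
  "psi V l 0 r = of_real (r powr (l + 1))"
| "psi V l (Suc k) r =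
     (LINT s|lebesgue_on {0<..<r}.
        of_real (1 / (2 * l + 1) * (r powr (l + 1) / s powr l - s powr (l + 1) / r powr l))
          * V s * psi V l k s)"

definition y_reg :: "(real \<Rightarrow> complex) \<Rightarrow> nat \<Rightarrow> nat \<Rightarrow> real \<Rightarrow> complex" where
  "y_reg V d m r = (\<Sum>k. psi V (ell d m) k r)"

definition alpha :: "(real \<Rightarrow> complex) \<Rightarrow> nat \<Rightarrow> nat \<Rightarrow> real \<Rightarrow> complex" where
  "alpha V d m r = (if r = 0 then 1 else y_reg V d m r / of_real (r powr (ell d m + 1)))"

text \<open>The value at the origin, where \<open>\<xi>\<close> is undefined, is irrelevant: a single point is a null
  set.\<close>

definition U_sol ::
  "(real \<Rightarrow> complex) \<Rightarrow> nat \<Rightarrow> (real^'n::finite \<Rightarrow> complex) \<Rightarrow> real^'n \<Rightarrow> complex" where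
  "U_sol V m p x =
     of_real (norm x ^ m) * alpha V CARD('n) m (norm x) * p (x /\<^sub>R norm x)"

definition annulus :: "real \<Rightarrow> (real^'n::finite) set" where
  "annulus \<epsilon> = {x. \<epsilon> < norm x \<and> norm x < 1}"

end

theory Submission
  imports Defs
begin

text \<open>
  Write \<open>\<alpha>\<close> for the radial factor and \<open>P\<close> for the homogeneous harmonic polynomial of degree \<open>m\<close>
  that restricts to \<open>p\<close>; off the origin the function in question is \<open>u(x) = \<alpha>(|x|) P(x)\<close>. Put
  \<open>N = 2 \<ell> + 1 = 2 m + n - 2\<close> in dimension \<open>n\<close>.

  Radial part. Dividing the recursion for \<open>\<psi>\<close> by \<open>r\<close> to the power \<open>\<ell> + 1\<close> gives a Volterra series
  with kernel \<open>s (1 - (s/r)^N) / N\<close> times \<open>V\<close>. Its terms are bounded by \<open>W^k / k!\<close> where \<open>W\<close> is the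
  indefinite integral of \<open>s |V(s)|\<close>; so \<open>\<alpha>\<close> is bounded and solves the integral equation
  (\<open>norm_series_term_le_weight_upto\<close>, \<open>regular_integral_equation\<close>). Consequently the flux
  \<open>r^(N+1) \<alpha>'(r)\<close> is the integral from \<open>0\<close> to \<open>r\<close> of \<open>s^(N+1) V(s) \<alpha>(s)\<close>, and \<open>\<alpha>'\<close> is integrable
  and \<open>O(1/r)\<close> (\<open>regular_eq_integral_slope\<close>). Both \<open>\<alpha>\<close> and the flux are thus indefinite integrals
  of integrable functions, and for the flux that is all one can say, as \<open>r |V(r)|\<close> is only integrable.

  Weak derivatives. The key is \<open>radial_integration_by_parts\<close>: if \<open>\<Gamma>\<close> is an indefinite integral of
  \<open>g\<close> and \<open>h\<close> is \<open>C\<^sup>1\<close> off the origin, then \<open>g(|x|) x_j/|x| h + \<Gamma>(|x|) \<partial>_j h\<close> has integral zero as soon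
  as everything in sight is integrable. On almost every line parallel to the \<open>j\<close>-th axis this is the
  fundamental theorem of calculus, and averaging over all lines is Fubini together with translation
  invariance. Lines through the origin form a null set, so the argument does not see the singularity there.
  Applied to \<open>\<alpha> P\<close> it yields the gradient \<open>\<alpha> \<partial>_i P + flux Q_i\<close> with \<open>Q_i = P x_i |x|^(-N-2)\<close>,
  and applied once more to the two summands it yields the second derivatives.

  Integrability. The gradient is \<open>O(1/|x|)\<close> and the second derivatives are
  \<open>O(1 + 1/|x|\<^sup>2 + |V(|x|)|)\<close>. In polar coordinates the volume element is at most a constant times
  \<open>r\<^sup>2 dr\<close> because \<open>n \<ge> 3\<close>, so the gradient is square integrable and the second derivatives are
  integrable over the whole ball, not just over annuli. Their trace is \<open>V u\<close>: the terms of first order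
  cancel by Euler's identity for \<open>P\<close> and \<open>N + 2 = 2 m + n\<close> (\<open>trace_hess\<close>). The statements on the
  annuli are restrictions of this, and testing the weak derivative of the gradient against a test
  function of the ball gives the weak equation.
\<close>

section \<open>Calculus of indefinite Lebesgue integrals on the line\<close>

text \<open>Fubini on the square, cut along its diagonal. Functions that are only indefinite integrals need not
  be differentiable anywhere, and this identity is what replaces the product rule for them.\<close>

lemma integral_product_split_triangle:
  fixes f g :: "real \<Rightarrow> 'a::{real_normed_field,banach,second_countable_topology}"
  assumes f: "integrable lborel f" and g: "integrable lborel g"
  shows "integrable lborel (\<lambda>s. f s * (\<integral>u. indicator {..s} u *\<^sub>R g u \<partial>lborel))"
    and "integrable lborel (\<lambda>u. (\<integral>s. indicator {..u} s *\<^sub>R f s \<partial>lborel) * g u)"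
    and "(\<integral>s. f s * (\<integral>u. indicator {..s} u *\<^sub>R g u \<partial>lborel) \<partial>lborel)
       + (\<integral>u. (\<integral>s. indicator {..u} s *\<^sub>R f s \<partial>lborel) * g u \<partial>lborel)
       = (\<integral>s. f s \<partial>lborel) * (\<integral>u. g u \<partial>lborel)"
proof -
  have [measurable]: "f \<in> borel_measurable borel" "g \<in> borel_measurable borel"
    using f g by auto
  have fg: "integrable (lborel \<Otimes>\<^sub>M lborel) (\<lambda>(s, u). f s * g u)"
  proof (rule lborel_pair.Fubini_integrable)
    show "integrable lborel (\<lambda>s. \<integral>u. norm (case (s, u) of (s, u) \<Rightarrow> f s * g u) \<partial>lborel)"
      using f by (simp add: norm_mult)
    show "AE s in lborel. integrable lborel (\<lambda>u. case (s, u) of (s, u) \<Rightarrow> f s * g u)"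
      using g by simp
  qed measurable
  have lower: "integrable (lborel \<Otimes>\<^sub>M lborel) (\<lambda>(s, u). indicator {..s} u *\<^sub>R (f s * g u))"
  proof (rule Bochner_Integration.integrable_bound[OF fg])
    have "(\<lambda>p. if snd p \<le> fst p then f (fst p) * g (snd p) else 0)
        \<in> borel_measurable (lborel \<Otimes>\<^sub>M lborel)" by measurable
    then show "(\<lambda>(s, u). indicator {..s} u *\<^sub>R (f s * g u)) \<in> borel_measurable (lborel \<Otimes>\<^sub>M lborel)"
      by (rule back_subst[where P="\<lambda>h. h \<in> _"]) (auto simp: fun_eq_iff)
  qed (auto simp: indicator_def)
  \<comment> \<open>the open half-line makes the two triangles disjoint; the diagonal is a null set\<close>
  have upper: "integrable (lborel \<Otimes>\<^sub>M lborel) (\<lambda>(s, u). indicator {..<u} s *\<^sub>R (f s * g u))"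
  proof (rule Bochner_Integration.integrable_bound[OF fg])
    have "(\<lambda>p. if fst p < snd p then f (fst p) * g (snd p) else 0)
        \<in> borel_measurable (lborel \<Otimes>\<^sub>M lborel)" by measurable
    then show "(\<lambda>(s, u). indicator {..<u} s *\<^sub>R (f s * g u)) \<in> borel_measurable (lborel \<Otimes>\<^sub>M lborel)"
      by (rule back_subst[where P="\<lambda>h. h \<in> _"]) (auto simp: fun_eq_iff)
  qed (auto simp: indicator_def)
  have inner1: "(\<integral>u. indicator {..s} u *\<^sub>R (f s * g u) \<partial>lborel)
      = f s * (\<integral>u. indicator {..s} u *\<^sub>R g u \<partial>lborel)" for s
    by (subst integral_mult_right_zero[symmetric]) (auto intro!: Bochner_Integration.integral_cong)
  have inner2: "(\<integral>s. indicator {..<u} s *\<^sub>R (f s * g u) \<partial>lborel)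
      = (\<integral>s. indicator {..u} s *\<^sub>R f s \<partial>lborel) * g u" for u
  proof -
    have "(\<integral>s. indicator {..<u} s *\<^sub>R (f s * g u) \<partial>lborel)
        = (\<integral>s. (indicator {..u} s *\<^sub>R f s) * g u \<partial>lborel)"
      by (rule integral_cong_AE)
        (use AE_lborel_singleton[of u] in \<open>auto simp: indicator_def elim!: eventually_mono\<close>)
    also have "\<dots> = (\<integral>s. indicator {..u} s *\<^sub>R f s \<partial>lborel) * g u"
      by (rule integral_mult_left_zero)
    finally show ?thesis .
  qed
  show "integrable lborel (\<lambda>s. f s * (\<integral>u. indicator {..s} u *\<^sub>R g u \<partial>lborel))"
    using lborel_pair.integrable_fst[OF lower] by (simp add: inner1)
  show "integrable lborel (\<lambda>u. (\<integral>s. indicator {..u} s *\<^sub>R f s \<partial>lborel) * g u)"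
    using lborel_pair.integrable_snd[OF upper] by (simp add: inner2)
  have "(\<integral>s. f s * (\<integral>u. indicator {..s} u *\<^sub>R g u \<partial>lborel) \<partial>lborel)
       + (\<integral>u. (\<integral>s. indicator {..u} s *\<^sub>R f s \<partial>lborel) * g u \<partial>lborel)
     = integral\<^sup>L (lborel \<Otimes>\<^sub>M lborel) (\<lambda>(s, u). indicator {..s} u *\<^sub>R (f s * g u))
     + integral\<^sup>L (lborel \<Otimes>\<^sub>M lborel) (\<lambda>(s, u). indicator {..<u} s *\<^sub>R (f s * g u))"
    using lborel_pair.integral_fst[OF lower] lborel_pair.integral_snd[OF upper]
    by (simp add: inner1 inner2)
  also have "\<dots> = integral\<^sup>L (lborel \<Otimes>\<^sub>M lborel) (\<lambda>p.
      (case p of (s, u) \<Rightarrow> indicator {..s} u *\<^sub>R (f s * g u))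
      + (case p of (s, u) \<Rightarrow> indicator {..<u} s *\<^sub>R (f s * g u)))"
    by (rule Bochner_Integration.integral_add[symmetric, OF lower upper])
  also have "\<dots> = integral\<^sup>L (lborel \<Otimes>\<^sub>M lborel) (\<lambda>(s, u). f s * g u)"
    by (rule Bochner_Integration.integral_cong) (auto simp: indicator_def)
  also have "\<dots> = (\<integral>s. f s \<partial>lborel) * (\<integral>u. g u \<partial>lborel)"
    using lborel_pair.integral_fst[OF fg] by simp
  finally show "(\<integral>s. f s * (\<integral>u. indicator {..s} u *\<^sub>R g u \<partial>lborel) \<partial>lborel)
       + (\<integral>u. (\<integral>s. indicator {..u} s *\<^sub>R f s \<partial>lborel) * g u \<partial>lborel)
       = (\<integral>s. f s \<partial>lborel) * (\<integral>u. g u \<partial>lborel)" .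
qed

text \<open>After subtraction of the values at \<open>a\<close> this is the triangle identity for the two densities
  restricted to \<open>{a..b}\<close>.\<close>

lemma integral_by_parts_indefinite:
  fixes f g F G :: "real \<Rightarrow> 'a::{real_normed_field,banach,second_countable_topology}"
  assumes ab: "a \<le> b"
    and f: "integrable lborel (\<lambda>t. indicator {a..b} t *\<^sub>R f t)"
    and g: "integrable lborel (\<lambda>t. indicator {a..b} t *\<^sub>R g t)"
    and F: "\<And>t. a \<le> t \<Longrightarrow> t \<le> b \<Longrightarrow> F t = F a + (\<integral>s. indicator {a..t} s *\<^sub>R f s \<partial>lborel)"
    and G: "\<And>t. a \<le> t \<Longrightarrow> t \<le> b \<Longrightarrow> G t = G a + (\<integral>s. indicator {a..t} s *\<^sub>R g s \<partial>lborel)"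
  shows "has_bochner_integral lborel (\<lambda>t. indicator {a..b} t *\<^sub>R (f t * G t + F t * g t)) (F b * G b - F a * G a)"
proof -
  let ?f = "\<lambda>t. indicator {a..b} t *\<^sub>R f t" and ?g = "\<lambda>t. indicator {a..b} t *\<^sub>R g t"
  note tri = integral_product_split_triangle[OF f g]
  have cut: "(\<lambda>s. indicator {..t} s *\<^sub>R indicator {a..b} s *\<^sub>R h s) = (\<lambda>s. indicator {a..t} s *\<^sub>R h s)"
    if "t \<le> b" for t and h :: "real \<Rightarrow> 'a"
    using that by (auto simp: indicator_def fun_eq_iff)
  have i1: "integrable lborel (\<lambda>t. ?f t * G a)" by (rule integrable_mult_left) (rule f)
  have i2: "integrable lborel (\<lambda>t. F a * ?g t)" by (rule integrable_mult_right) (rule g)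
  let ?S = "\<lambda>t. ((?f t * G a + ?f t * (\<integral>s. indicator {..t} s *\<^sub>R ?g s \<partial>lborel))
           + (F a * ?g t + (\<integral>s. indicator {..t} s *\<^sub>R ?f s \<partial>lborel) * ?g t))"
  have eq: "(\<lambda>t. indicator {a..b} t *\<^sub>R (f t * G t + F t * g t)) = ?S"
  proof
    fix t
    show "indicator {a..b} t *\<^sub>R (f t * G t + F t * g t)
      = ((?f t * G a + ?f t * (\<integral>s. indicator {..t} s *\<^sub>R ?g s \<partial>lborel))
           + (F a * ?g t + (\<integral>s. indicator {..t} s *\<^sub>R ?f s \<partial>lborel) * ?g t))"
    proof (cases "t \<in> {a..b}")
      case True
      then have "t \<le> b" by simp
      show ?thesis unfolding cut[OF \<open>t \<le> b\<close>] using True F[of t] G[of t] by (simp add: algebra_simps)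
    qed simp
  qed
  have "(\<integral>t. ?S t \<partial>lborel) = ((\<integral>t. ?f t \<partial>lborel) * G a + (\<integral>t. ?f t * (\<integral>s. indicator {..t} s *\<^sub>R ?g s \<partial>lborel) \<partial>lborel))
      + (F a * (\<integral>t. ?g t \<partial>lborel) + (\<integral>t. (\<integral>s. indicator {..t} s *\<^sub>R ?f s \<partial>lborel) * ?g t \<partial>lborel))"
    using Bochner_Integration.integral_add[OF Bochner_Integration.integrable_add[OF i1 tri(1)]
        Bochner_Integration.integrable_add[OF i2 tri(2)]]
      Bochner_Integration.integral_add[OF i1 tri(1)] Bochner_Integration.integral_add[OF i2 tri(2)]
    by (simp only: integral_mult_left_zero integral_mult_right_zero)
  also have "\<dots> = F b * G b - F a * G a"
    using tri(3) F[of b] G[of b] ab by (simp add: algebra_simps)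
  finally have "(\<integral>t. ?S t \<partial>lborel) = F b * G b - F a * G a" .
  moreover have "integrable lborel ?S"
    using i1 i2 tri(1,2) by (intro Bochner_Integration.integrable_add)
  ultimately show ?thesis unfolding eq has_bochner_integral_iff by simp
qed

text \<open>This is \<open>(W^(k+1))' = (k+1) w W^k\<close> in integrated form. The triangle identity for \<open>w\<close> and \<open>w W^k\<close>
  expresses the integral of \<open>w W^(k+1)\<close> through itself, with the induction hypothesis
  turning the inner integral of \<open>w W^k\<close> into \<open>W^(k+1) / (k+1)\<close>.\<close>

lemma integral_power_indefinite:
  fixes w :: "real \<Rightarrow> real"
  assumes w: "integrable lborel w"
  defines "W \<equiv> \<lambda>t. \<integral>s. indicator {..t} s *\<^sub>R w s \<partial>lborel"
  shows "integrable lborel (\<lambda>s. w s * W s ^ k)"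
    and "(\<integral>s. indicator {..r} s *\<^sub>R (w s * W s ^ k) \<partial>lborel) = W r ^ Suc k / (Suc k)"
proof -
  have "integrable lborel (\<lambda>s. w s * W s ^ k)
    \<and> (\<forall>r. (\<integral>s. indicator {..r} s *\<^sub>R (w s * W s ^ k) \<partial>lborel) = W r ^ Suc k / (Suc k))"
  proof (induction k)
    case 0
    then show ?case using w by (simp add: W_def)
  next
    case (Suc k)
    let ?h = "\<lambda>s. w s * W s ^ k"
    have H: "integrable lborel ?h"
      and IH: "\<And>r. (\<integral>s. indicator {..r} s *\<^sub>R ?h s \<partial>lborel) = W r ^ Suc k / (Suc k)"
      using Suc by auto
    have int: "integrable lborel (\<lambda>s. w s * W s ^ Suc k)"
      using integrable_mult_left[OF integral_product_split_triangle(1)[OF w H], of "Suc k"]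
      unfolding IH by (simp add: ac_simps)
    have "(\<integral>s. indicator {..r} s *\<^sub>R (w s * W s ^ Suc k) \<partial>lborel) = W r ^ Suc (Suc k) / (Suc (Suc k))" for r
    proof -
      let ?w = "\<lambda>s. indicator {..r} s *\<^sub>R w s" and ?k = "\<lambda>s. indicator {..r} s *\<^sub>R ?h s"
      let ?X = "(\<integral>s. indicator {..r} s *\<^sub>R (w s * W s ^ Suc k) \<partial>lborel)"
      have wr: "integrable lborel ?w" "integrable lborel ?k"
        using integrable_mult_indicator[of "{..r}" lborel w]
          integrable_mult_indicator[of "{..r}" lborel ?h] w H by simp_all
      have cut: "(\<integral>u. indicator {..s} u *\<^sub>R indicator {..r} u *\<^sub>R h u \<partial>lborel)
          = (\<integral>u. indicator {..s} u *\<^sub>R h u \<partial>lborel)" if "s \<le> r" for s and h :: "real \<Rightarrow> real"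
        using that by (intro Bochner_Integration.integral_cong) (auto simp: indicator_def)
      have 1: "(\<integral>s. ?w s * (\<integral>u. indicator {..s} u *\<^sub>R ?k u \<partial>lborel) \<partial>lborel) = ?X / Suc k"
        (is "?l = _")
      proof -
        have "?l = (\<integral>s. (indicator {..r} s *\<^sub>R (w s * W s ^ Suc k)) / Suc k \<partial>lborel)"
        proof (rule Bochner_Integration.integral_cong[OF refl])
          fix s
          show "?w s * (\<integral>u. indicator {..s} u *\<^sub>R ?k u \<partial>lborel)
              = (indicator {..r} s *\<^sub>R (w s * W s ^ Suc k)) / Suc k"
          proof (cases "s \<le> r")
            case True
            show ?thesis unfolding cut[OF True] IH using True by simp
          qed simp
        qed
        then show ?thesis by simp
      qed
      have 2: "(\<integral>s. (\<integral>u. indicator {..s} u *\<^sub>R ?w u \<partial>lborel) * ?k s \<partial>lborel) = ?X"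
      proof (rule Bochner_Integration.integral_cong[OF refl])
        fix s
        show "(\<integral>u. indicator {..s} u *\<^sub>R ?w u \<partial>lborel) * ?k s = indicator {..r} s *\<^sub>R (w s * W s ^ Suc k)"
        proof (cases "s \<le> r")
          case True
          show ?thesis unfolding cut[OF True] by (simp add: True W_def)
        qed simp
      qed
      have "?X / Suc k + ?X = W r * (W r ^ Suc k / Suc k)"
        using integral_product_split_triangle(3)[OF wr] unfolding 1 2 IH by (simp add: W_def)
      then show ?thesis by (simp add: field_simps)
    qed
    with int show ?case by simp
  qed
  then show "integrable lborel (\<lambda>s. w s * W s ^ k)"
    and "(\<integral>s. indicator {..r} s *\<^sub>R (w s * W s ^ k) \<partial>lborel) = W r ^ Suc k / (Suc k)" by auto
qed

text \<open>The real substitution rule for the real and the imaginary part. Because \<open>\<rho>\<close> is monotone, \<open>g\<close> may be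
  merely integrable.\<close>

lemma integral_substitution_complex:
  fixes g :: "real \<Rightarrow> complex" and \<rho> \<rho>' :: "real \<Rightarrow> real"
  assumes g: "integrable lborel g"
    and \<rho>: "\<And>t. t \<in> {a..b} \<Longrightarrow> (\<rho> has_real_derivative \<rho>' t) (at t)"
    and cont: "continuous_on {a..b} \<rho>'" and nn: "\<And>t. t \<in> {a..b} \<Longrightarrow> 0 \<le> \<rho>' t" and ab: "a \<le> b"
  shows "integrable lborel (\<lambda>t. indicator {a..b} t *\<^sub>R (g (\<rho> t) * of_real (\<rho>' t)))"
    and "(\<integral>t. indicator {a..b} t *\<^sub>R (g (\<rho> t) * of_real (\<rho>' t)) \<partial>lborel)
        = (\<integral>s. indicator {\<rho> a..\<rho> b} s *\<^sub>R g s \<partial>lborel)"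
proof -
  have gr: "integrable lborel (\<lambda>s. indicator {\<rho> a..\<rho> b} s *\<^sub>R g s)"
    using g by (intro integrable_mult_indicator) auto
  have R: "set_integrable lborel {\<rho> a..\<rho> b} (\<lambda>s. Re (g s))" "set_integrable lborel {\<rho> a..\<rho> b} (\<lambda>s. Im (g s))"
    using integrable_Re[OF gr] integrable_Im[OF gr] by (simp_all add: set_integrable_def)
  note S1 = integral_substitution[OF R(1) \<rho> cont nn ab]
  note S2 = integral_substitution[OF R(2) \<rho> cont nn ab]
  have eq: "(\<lambda>t. indicator {a..b} t *\<^sub>R (g (\<rho> t) * of_real (\<rho>' t))) =
    (\<lambda>t. of_real (Re (g (\<rho> t)) * \<rho>' t * indicator {a..b} t)
        + \<i> * of_real (Im (g (\<rho> t)) * \<rho>' t * indicator {a..b} t))"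
    by (auto simp: fun_eq_iff indicator_def complex_eq_iff)
  have eq2: "(\<lambda>s. indicator {\<rho> a..\<rho> b} s *\<^sub>R g s) =
    (\<lambda>s. of_real (Re (g s) * indicator {\<rho> a..\<rho> b} s) + \<i> * of_real (Im (g s) * indicator {\<rho> a..\<rho> b} s))"
    by (auto simp: fun_eq_iff indicator_def complex_eq_iff)
  have I1: "integrable lborel (\<lambda>t. Re (g (\<rho> t)) * \<rho>' t * indicator {a..b} t)"
    "integrable lborel (\<lambda>t. Im (g (\<rho> t)) * \<rho>' t * indicator {a..b} t)"
    using S1(1) S2(1) by (simp_all add: set_integrable_def mult.commute mult.left_commute)
  have I2: "integrable lborel (\<lambda>s. Re (g s) * indicator {\<rho> a..\<rho> b} s)"
     "integrable lborel (\<lambda>s. Im (g s) * indicator {\<rho> a..\<rho> b} s)"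
    using R by (simp_all add: set_integrable_def mult.commute)
  show "integrable lborel (\<lambda>t. indicator {a..b} t *\<^sub>R (g (\<rho> t) * of_real (\<rho>' t)))"
    unfolding eq using I1 by (intro Bochner_Integration.integrable_add integrable_of_real integrable_mult_right)
  show "(\<integral>t. indicator {a..b} t *\<^sub>R (g (\<rho> t) * of_real (\<rho>' t)) \<partial>lborel)
        = (\<integral>s. indicator {\<rho> a..\<rho> b} s *\<^sub>R g s \<partial>lborel)"
    unfolding eq eq2 using I1 I2 S1(2) S2(2)
    by (subst (1 2) Bochner_Integration.integral_add)
      (auto simp del: of_real_mult intro!: integrable_of_real integrable_mult_right)
qed

lemma indefinite_integral_split:
  fixes g :: "real \<Rightarrow> 'a::{banach,second_countable_topology}"
  assumes g: "integrable lborel g" and "r \<le> s"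
  shows "(\<integral>u. indicator {..s} u *\<^sub>R g u \<partial>lborel)
    = (\<integral>u. indicator {..r} u *\<^sub>R g u \<partial>lborel) + (\<integral>u. indicator {r..s} u *\<^sub>R g u \<partial>lborel)"
proof -
  have [measurable]: "g \<in> borel_measurable borel" using g by auto
  have "(\<integral>u. indicator {..s} u *\<^sub>R g u \<partial>lborel)
     = (\<integral>u. (indicator {..r} u *\<^sub>R g u + indicator {r..s} u *\<^sub>R g u) \<partial>lborel)"
    using \<open>r \<le> s\<close> by (intro integral_cong_AE)
      (use AE_lborel_singleton[of r] in \<open>auto simp: indicator_def elim!: eventually_mono\<close>)
  also have "\<dots> = (\<integral>u. indicator {..r} u *\<^sub>R g u \<partial>lborel) + (\<integral>u. indicator {r..s} u *\<^sub>R g u \<partial>lborel)"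
    using g by (intro Bochner_Integration.integral_add integrable_mult_indicator) auto
  finally show ?thesis .
qed

lemma indefinite_integral_measurable:
  fixes g :: "real \<Rightarrow> 'a::{banach,second_countable_topology}"
  assumes [measurable]: "g \<in> borel_measurable borel"
  shows "(\<lambda>r. \<integral>s. indicator {..r} s *\<^sub>R g s \<partial>lborel) \<in> borel_measurable borel"
proof -
  have "(\<lambda>p. if snd p \<le> fst p then g (snd p) else 0) \<in> borel_measurable (borel \<Otimes>\<^sub>M lborel)"
    by measurable
  then have "(\<lambda>(r, s). indicator {..r} s *\<^sub>R g s) \<in> borel_measurable (borel \<Otimes>\<^sub>M lborel)"
    by (rule back_subst[where P="\<lambda>h. h \<in> _"]) (auto simp: fun_eq_iff)
  then show ?thesis by (rule lborel.borel_measurable_lebesgue_integral)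
qed

text \<open>By substitution, \<open>\<Gamma> \<circ> \<rho>\<close> is an indefinite integral of \<open>(g \<circ> \<rho>) \<rho>'\<close>; the claim is then the product
  rule for the indefinite integrals \<open>\<Gamma> \<circ> \<rho>\<close> and \<open>H\<close>.\<close>

lemma chain_product_increasing:
  fixes g \<Gamma> H H' :: "real \<Rightarrow> complex" and \<rho> \<rho>' :: "real \<Rightarrow> real"
  assumes g: "integrable lborel g"
    and \<Gamma>: "\<And>r s. r \<le> s \<Longrightarrow> \<Gamma> s = \<Gamma> r + (\<integral>u. indicator {r..s} u *\<^sub>R g u \<partial>lborel)"
    and \<rho>: "\<And>t. t \<in> {a..b} \<Longrightarrow> (\<rho> has_real_derivative \<rho>' t) (at t)"
    and cont: "continuous_on {a..b} \<rho>'" and nn: "\<And>t. t \<in> {a..b} \<Longrightarrow> 0 \<le> \<rho>' t" and ab: "a \<le> b"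
    and H: "\<And>t. t \<in> {a..b} \<Longrightarrow> (H has_vector_derivative H' t) (at t)"
    and H': "continuous_on {a..b} H'"
  shows "has_bochner_integral lborel
      (\<lambda>t. indicator {a..b} t *\<^sub>R (g (\<rho> t) * of_real (\<rho>' t) * H t + \<Gamma> (\<rho> t) * H' t))
      (\<Gamma> (\<rho> b) * H b - \<Gamma> (\<rho> a) * H a)"
proof (rule integral_by_parts_indefinite[OF ab])
  have mono: "\<rho> a \<le> \<rho> t" if "a \<le> t" "t \<le> b" for t
    by (rule deriv_nonneg_imp_mono[OF \<rho> nn]) (use that in auto)
  show "integrable lborel (\<lambda>t. indicator {a..b} t *\<^sub>R (g (\<rho> t) * of_real (\<rho>' t)))"
    by (rule integral_substitution_complex[OF g \<rho> cont nn ab])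
  show "integrable lborel (\<lambda>t. indicator {a..b} t *\<^sub>R H' t)"
    using borel_integrable_compact[of "{a..b}" H'] H' by (simp add: indicator_scaleR_eq_if)
  show "\<Gamma> (\<rho> t) = \<Gamma> (\<rho> a) + (\<integral>s. indicator {a..t} s *\<^sub>R (g (\<rho> s) * of_real (\<rho>' s)) \<partial>lborel)"
    if "a \<le> t" "t \<le> b" for t
    using that by (subst integral_substitution_complex(2)[OF g])
      (auto intro!: \<rho> nn \<Gamma> mono continuous_on_subset[OF cont])
  show "H t = H a + (\<integral>s. indicator {a..t} s *\<^sub>R H' s \<partial>lborel)" if "a \<le> t" "t \<le> b" for t
    using that by (subst integral_FTC_atLeastAtMost[of a t H H'])
      (auto intro!: has_vector_derivative_at_within[OF H] continuous_on_subset[OF H'])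
qed

text \<open>The reflection \<open>t \<mapsto> - t\<close> turns a decreasing \<open>\<rho>\<close> into an increasing one.\<close>

lemma chain_product_decreasing:
  fixes g \<Gamma> H H' :: "real \<Rightarrow> complex" and \<rho> \<rho>' :: "real \<Rightarrow> real"
  assumes g: "integrable lborel g"
    and \<Gamma>: "\<And>r s. r \<le> s \<Longrightarrow> \<Gamma> s = \<Gamma> r + (\<integral>u. indicator {r..s} u *\<^sub>R g u \<partial>lborel)"
    and \<rho>: "\<And>t. t \<in> {a..b} \<Longrightarrow> (\<rho> has_real_derivative \<rho>' t) (at t)"
    and cont: "continuous_on {a..b} \<rho>'" and np: "\<And>t. t \<in> {a..b} \<Longrightarrow> \<rho>' t \<le> 0" and ab: "a \<le> b"
    and H: "\<And>t. t \<in> {a..b} \<Longrightarrow> (H has_vector_derivative H' t) (at t)"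
    and H': "continuous_on {a..b} H'"
  shows "has_bochner_integral lborel
      (\<lambda>t. indicator {a..b} t *\<^sub>R (g (\<rho> t) * of_real (\<rho>' t) * H t + \<Gamma> (\<rho> t) * H' t))
      (\<Gamma> (\<rho> b) * H b - \<Gamma> (\<rho> a) * H a)"
proof -
  have neg: "continuous_on {-b..-a} (\<lambda>t. f (- t))" if "continuous_on {a..b} f" for f :: "real \<Rightarrow> 'z::topological_space"
    by (rule continuous_on_compose2[OF that]) (auto intro!: continuous_intros)
  let ?K = "\<lambda>t. indicator {a..b} t *\<^sub>R (g (\<rho> t) * of_real (\<rho>' t) * H t + \<Gamma> (\<rho> t) * H' t)"
  have "has_bochner_integral lborel (\<lambda>t. indicator {-b..-a} t *\<^sub>R
        (g (\<rho> (- t)) * of_real (- \<rho>' (- t)) * H (- t) + \<Gamma> (\<rho> (- t)) * (- H' (- t))))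
      (\<Gamma> (\<rho> (- (- a))) * H (- (- a)) - \<Gamma> (\<rho> (- (- b))) * H (- (- b)))"
  proof (rule chain_product_increasing[OF g \<Gamma>])
    fix t assume t: "t \<in> {-b..-a}"
    then have t': "- t \<in> {a..b}" by auto
    show "((\<lambda>t. \<rho> (- t)) has_real_derivative - \<rho>' (- t)) (at t)"
      using DERIV_mirror[of "\<rho>"] \<rho>[OF t'] by blast
    show "0 \<le> - \<rho>' (- t)" using np[OF t'] by simp
    have "((\<lambda>t. H (- t)) has_vector_derivative (-1) *\<^sub>R H' (- t)) (at t)"
    proof -
      have "(uminus has_vector_derivative (- 1 :: real)) (at t)"
        by (auto intro!: derivative_eq_intros)
      from vector_diff_chain_at[OF this H[OF t']] show ?thesis by (simp add: o_def)
    qed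
    then show "((\<lambda>t. H (- t)) has_vector_derivative - H' (- t)) (at t)" by simp
  qed (use ab in \<open>auto intro!: continuous_on_minus neg cont H'\<close>)
  also have "(\<lambda>t. indicator {-b..-a} t *\<^sub>R
        (g (\<rho> (- t)) * of_real (- \<rho>' (- t)) * H (- t) + \<Gamma> (\<rho> (- t)) * (- H' (- t))))
      = (\<lambda>t. - ?K (0 + (-1) * t))"
    by (auto simp: indicator_def fun_eq_iff)
  finally have "has_bochner_integral lborel (\<lambda>t. - (- ?K (0 + (-1) * t)))
      (- (\<Gamma> (\<rho> a) * H a - \<Gamma> (\<rho> b) * H b))"
    by (intro has_bochner_integral_minus) simp
  then show ?thesis
    by (subst lborel_has_bochner_integral_real_affine_iff[of "-1" _ _ 0]) simp_all
qed


section \<open>Integration by parts on space\<close>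

text \<open>All differentiation below takes place on lines parallel to an axis, so the derivative along the line
  is the notion that the fundamental theorem of calculus wants.\<close>

definition has_partial :: "(real^'n::finite \<Rightarrow> complex) \<Rightarrow> complex \<Rightarrow> 'n \<Rightarrow> real^'n \<Rightarrow> bool" where
  "has_partial h d j x \<longleftrightarrow> ((\<lambda>t. h (x + t *\<^sub>R axis j 1)) has_vector_derivative d) (at 0)"

lemma has_partial_along_line:
  assumes "has_partial h d j (x + t *\<^sub>R axis j 1)"
  shows "((\<lambda>s. h (x + s *\<^sub>R axis j 1)) has_vector_derivative d) (at t)"
proof -
  have "((\<lambda>s. h (x + t *\<^sub>R axis j 1 + s *\<^sub>R axis j 1)) has_vector_derivative d) (at (t - t))"
    using assms by (simp add: has_partial_def)
  moreover have "((\<lambda>s. s - t) has_vector_derivative 1) (at t)"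
    by (auto intro!: derivative_eq_intros)
  ultimately have "((\<lambda>s. h (x + t *\<^sub>R axis j 1 + s *\<^sub>R axis j 1)) \<circ> (\<lambda>s. s - t) has_vector_derivative 1 *\<^sub>R d) (at t)"
    by (intro vector_diff_chain_at)
  then show ?thesis by (simp add: o_def scaleR_left_diff_distrib)
qed

lemma norm_line_derivative:
  fixes x :: "real^'n::finite"
  assumes "x + t *\<^sub>R axis j 1 \<noteq> 0"
  shows "((\<lambda>s. norm (x + s *\<^sub>R axis j 1)) has_real_derivative
      (x + t *\<^sub>R axis j 1) $ j / norm (x + t *\<^sub>R axis j 1)) (at t)"
proof -
  let ?y = "x + t *\<^sub>R axis j 1"
  have "((\<lambda>s. x + s *\<^sub>R axis j 1) has_derivative (\<lambda>s. s *\<^sub>R axis j 1)) (at t)"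
    by (auto intro!: derivative_eq_intros)
  from has_derivative_compose[OF this has_derivative_norm[OF assms]]
  have "((\<lambda>s. norm (x + s *\<^sub>R axis j 1)) has_derivative (\<lambda>s. (s *\<^sub>R axis j 1) \<bullet> sgn ?y)) (at t)" .
  moreover have "(\<lambda>s. (s *\<^sub>R axis j 1) \<bullet> sgn ?y) = (\<lambda>s. (?y $ j / norm ?y) * s)"
    by (auto simp: sgn_div_norm inner_axis' field_simps add_divide_distrib fun_eq_iff)
  ultimately show ?thesis by (simp only: has_field_derivative_def)
qed

lemma has_bochner_integral_join:
  fixes f :: "real \<Rightarrow> 'a::{banach,second_countable_topology}"
  assumes "has_bochner_integral lborel (\<lambda>t. indicator {a..c} t *\<^sub>R f t) I"
    and "has_bochner_integral lborel (\<lambda>t. indicator {c..b} t *\<^sub>R f t) J"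
    and "a \<le> c" "c \<le> b"
  shows "(\<integral>t. indicator {a..b} t *\<^sub>R f t \<partial>lborel) = I + J"
proof -
  let ?A = "\<lambda>t. indicator {a..c} t *\<^sub>R f t" and ?B = "\<lambda>t. indicator {c..b} t *\<^sub>R f t"
  have [measurable]: "?A \<in> borel_measurable borel" "?B \<in> borel_measurable borel"
    using assms(1,2) by (auto simp: has_bochner_integral_iff)
  have eq: "(\<lambda>t. indicator {a..b} t *\<^sub>R f t) = (\<lambda>t. if t \<le> c then ?A t else ?B t)"
    using assms(3,4) by (auto simp: indicator_def fun_eq_iff)
  have "(\<integral>t. (if t \<le> c then ?A t else ?B t) \<partial>lborel) = (\<integral>t. ?A t + ?B t \<partial>lborel)"
    by (rule integral_cong_AE; (measurable; fail)?)
      (use AE_lborel_singleton[of c] in \<open>auto simp: indicator_def elim!: eventually_mono\<close>)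
  also have "\<dots> = I + J"
    using assms(1,2) by (simp add: has_bochner_integral_iff)
  finally show ?thesis unfolding eq .
qed

lemma lborel_integral_translation:
  fixes f :: "'a::euclidean_space \<Rightarrow> 'b::{banach,second_countable_topology}"
  assumes "integrable lborel f"
  shows "integrable lborel (\<lambda>x. f (x + c))"
    and "(\<integral>x. f (x + c) \<partial>lborel) = (\<integral>x. f x \<partial>lborel)"
proof -
  have f: "integrable (distr lborel borel ((+) c)) f"
    using assms by (simp add: lborel_distr_plus)
  then show "integrable lborel (\<lambda>x. f (x + c))"
    using integrable_distr[of "(+) c" lborel borel f] by (simp add: add.commute)
  have "(\<integral>x. f x \<partial>lborel) = (\<integral>x. f x \<partial>distr lborel borel ((+) c))"
    by (simp add: lborel_distr_plus)
  also have "\<dots> = (\<integral>x. f (x + c) \<partial>lborel)"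
    using assms by (subst integral_distr) (auto simp: add.commute)
  finally show "(\<integral>x. f (x + c) \<partial>lborel) = (\<integral>x. f x \<partial>lborel)" by simp
qed

text \<open>Integrate the hypothesis over \<open>x\<close>. Each slice of the left-hand side at fixed \<open>t\<close> has the integral of
  \<open>G\<close>, and the two terms on the right cancel, both by translation invariance.\<close>

lemma integral_directional_derivative_zero:
  fixes F G :: "'a::euclidean_space \<Rightarrow> 'b::{banach,second_countable_topology}"
  assumes F: "integrable lborel F" and G: "integrable lborel G"
    and FTC: "AE x in lborel. (\<integral>t. indicator {0..1} t *\<^sub>R G (x + t *\<^sub>R e) \<partial>lborel) = F (x + e) - F x"
  shows "(\<integral>x. G x \<partial>lborel) = 0"
proof -
  have [measurable]: "G \<in> borel_measurable borel" "F \<in> borel_measurable borel" using F G by auto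
  let ?H = "\<lambda>t x. indicator {0..1::real} t *\<^sub>R G (x + t *\<^sub>R e)"
  have pair: "integrable (lborel \<Otimes>\<^sub>M lborel) (case_prod ?H)"
  proof (rule lborel_pair.Fubini_integrable)
    have "(\<lambda>t. \<integral>x. norm (case (t, x) of (t, x) \<Rightarrow> ?H t x) \<partial>lborel)
        = (\<lambda>t. indicator {0..1} t *\<^sub>R (\<integral>x. norm (G x) \<partial>lborel))"
      using lborel_integral_translation(2)[OF integrable_norm[OF G]] by (auto simp: fun_eq_iff)
    then show "integrable lborel (\<lambda>t. \<integral>x. norm (case (t, x) of (t, x) \<Rightarrow> ?H t x) \<partial>lborel)"
      by simp
    show "AE t in lborel. integrable lborel (\<lambda>x. case (t, x) of (t, x) \<Rightarrow> ?H t x)"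
      using lborel_integral_translation(1)[OF G] by simp
  qed measurable
  have "(\<integral>x. G x \<partial>lborel) = (\<integral>t. indicator {0..1::real} t *\<^sub>R (\<integral>x. G x \<partial>lborel) \<partial>lborel)"
    by simp
  also have "\<dots> = (\<integral>t. (\<integral>x. ?H t x \<partial>lborel) \<partial>lborel)"
    using lborel_integral_translation(2)[OF G] by simp
  also have "\<dots> = (\<integral>x. (\<integral>t. ?H t x \<partial>lborel) \<partial>lborel)"
    by (rule lborel_pair.Fubini_integral[symmetric, OF pair])
  also have "\<dots> = (\<integral>x. F (x + e) - F x \<partial>lborel)"
    by (rule integral_cong_AE; (measurable; fail)?) (use FTC in auto)
  also have "\<dots> = 0"
    using lborel_integral_translation[OF F] F by simp
  finally show ?thesis .
qed

lemma AE_off_axis: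
  fixes j k :: "'n::finite"
  shows "AE x in (lborel :: (real^'n) measure). x $ k \<noteq> 0"
proof -
  have "negligible {x :: real^'n. x $ k = 0}" by (rule negligible_standard_hyperplane_cart)
  then have "AE x in (lebesgue :: (real^'n) measure). x $ k \<noteq> 0"
    unfolding negligible_iff_null_sets by (auto dest: AE_not_in)
  then show ?thesis by (simp add: AE_completion_iff)
qed

text \<open>In dimension at least two almost every line parallel to the \<open>j\<close>-th axis misses the origin. Along
  such a line the norm is smooth, decreases up to the foot of the perpendicular from the origin and
  increases afterwards, so that the chain rule for monotone substitutions applies to each half. A
  singularity at the origin is harmless as long as the two integrability assumptions hold.\<close>

lemma radial_integration_by_parts:
  fixes h h' :: "real^'n::finite \<Rightarrow> complex" and g \<Gamma> :: "real \<Rightarrow> complex"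
  assumes dim: "CARD('n) \<ge> 2"
    and g: "integrable lborel g"
    and \<Gamma>: "\<And>r s. r \<le> s \<Longrightarrow> \<Gamma> s = \<Gamma> r + (\<integral>u. indicator {r..s} u *\<^sub>R g u \<partial>lborel)"
    and h: "\<And>x. x \<noteq> 0 \<Longrightarrow> has_partial h (h' x) j x" and h': "continuous_on (- {0}) h'"
    and F: "integrable lborel (\<lambda>x. \<Gamma> (norm x) * h x)"
    and G: "integrable lborel (\<lambda>x. g (norm x) * of_real (x $ j / norm x) * h x + \<Gamma> (norm x) * h' x)"
  shows "(\<integral>x. g (norm x) * of_real (x $ j / norm x) * h x + \<Gamma> (norm x) * h' x \<partial>lborel) = 0"
proof (rule integral_directional_derivative_zero[OF F G, where e = "axis j 1"])
  have "\<exists>k. k \<noteq> j"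
  proof (rule ccontr)
    assume "\<nexists>k. k \<noteq> j"
    then have "(UNIV :: 'n set) = {j}" by auto
    then have "CARD('n) = card {j}" by (rule arg_cong)
    then show False using dim by simp
  qed
  then obtain k where k: "k \<noteq> j" by blast
  show "AE x in lborel. (\<integral>t. indicator {0..1} t *\<^sub>R (g (norm (x + t *\<^sub>R axis j 1))
        * of_real ((x + t *\<^sub>R axis j 1) $ j / norm (x + t *\<^sub>R axis j 1)) * h (x + t *\<^sub>R axis j 1)
        + \<Gamma> (norm (x + t *\<^sub>R axis j 1)) * h' (x + t *\<^sub>R axis j 1)) \<partial>lborel)
      = \<Gamma> (norm (x + axis j 1)) * h (x + axis j 1) - \<Gamma> (norm x) * h x"
    using AE_off_axis[of k]
  proof (rule eventually_mono)
    fix x :: "real^'n" assume "x $ k \<noteq> 0"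
    have nz: "x + t *\<^sub>R axis j 1 \<noteq> 0" for t
    proof
      assume "x + t *\<^sub>R axis j 1 = 0"
      then have "(x + t *\<^sub>R axis j 1) $ k = 0" by simp
      then show False using k \<open>x $ k \<noteq> 0\<close> by (simp add: axis_def)
    qed
    let ?l = "\<lambda>t. x + t *\<^sub>R axis j 1"
    let ?\<rho>' = "\<lambda>t. ?l t $ j / norm (?l t)"
    let ?K = "\<lambda>t. g (norm (?l t)) * of_real (?\<rho>' t) * h (?l t) + \<Gamma> (norm (?l t)) * h' (?l t)"
    have d\<rho>: "((\<lambda>t. norm (?l t)) has_real_derivative ?\<rho>' t) (at t)" for t
      by (rule norm_line_derivative[OF nz])
    have c\<rho>: "continuous_on S ?\<rho>'" for S
      by (intro continuous_intros) (use nz in auto)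
    have dh: "((\<lambda>t. h (?l t)) has_vector_derivative h' (?l t)) (at t)" for t
      by (rule has_partial_along_line[OF h[OF nz]])
    have ch: "continuous_on S (\<lambda>t. h' (?l t))" for S
      by (rule continuous_on_compose2[OF h']) (use nz in \<open>auto intro!: continuous_intros\<close>)
    \<comment> \<open>the foot of the perpendicular is at \<open>t = - x_j\<close>, which may lie outside the unit segment\<close>
    have sgn: "?\<rho>' t \<le> 0 \<longleftrightarrow> t \<le> - x $ j" "0 \<le> ?\<rho>' t \<longleftrightarrow> - x $ j \<le> t" for t
      using nz[of t] by (auto simp: axis_def divide_le_0_iff zero_le_divide_iff)
    have dec: "has_bochner_integral lborel (\<lambda>t. indicator {a..b} t *\<^sub>R ?K t)
        (\<Gamma> (norm (?l b)) * h (?l b) - \<Gamma> (norm (?l a)) * h (?l a))" if "a \<le> b" "b \<le> - x $ j" for a b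
      by (rule chain_product_decreasing[OF g \<Gamma> d\<rho> c\<rho> _ _ dh ch])
        (use that in \<open>auto simp only: sgn atLeastAtMost_iff\<close>)
    have inc: "has_bochner_integral lborel (\<lambda>t. indicator {a..b} t *\<^sub>R ?K t)
        (\<Gamma> (norm (?l b)) * h (?l b) - \<Gamma> (norm (?l a)) * h (?l a))" if "a \<le> b" "- x $ j \<le> a" for a b
      by (rule chain_product_increasing[OF g \<Gamma> d\<rho> c\<rho> _ _ dh ch])
        (use that in \<open>auto simp only: sgn atLeastAtMost_iff\<close>)
    have "(\<integral>t. indicator {0..1} t *\<^sub>R ?K t \<partial>lborel)
        = \<Gamma> (norm (?l 1)) * h (?l 1) - \<Gamma> (norm (?l 0)) * h (?l 0)"
    proof -
      consider "- x $ j \<le> 0" | "1 \<le> - x $ j" | "0 \<le> - x $ j" "- x $ j \<le> 1" by linarith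
      then show ?thesis
      proof cases
        case 1
        then show ?thesis by (intro has_bochner_integral_integral_eq inc) simp_all
      next
        case 2
        then show ?thesis by (intro has_bochner_integral_integral_eq dec) simp_all
      next
        case 3
        from has_bochner_integral_join[OF dec[OF 3(1) order_refl] inc[OF 3(2) order_refl] 3]
        show ?thesis by simp
      qed
    qed
    then show "(\<integral>t. indicator {0..1} t *\<^sub>R ?K t \<partial>lborel)
      = \<Gamma> (norm (x + axis j 1)) * h (x + axis j 1) - \<Gamma> (norm x) * h x" by simp
  qed
qed

section \<open>Integrals of radial functions over the ball\<close>

text \<open>Polar coordinates for radial functions: a finite measure on the line is determined by its values on
  half-lines, and those are differences of volumes of balls.\<close>

lemma norm_distribution_ball:
  defines "c \<equiv> real CARD('n) * unit_ball_vol (real CARD('n))"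
  shows "distr (density lborel (indicator (ball 0 1))) borel (norm :: real^'n::finite \<Rightarrow> real)
    = density lborel (\<lambda>r. ennreal (c * r ^ (CARD('n) - 1)) * indicator {0..1} r)" (is "?M = ?N")
proof (rule measure_eqI_lessThan)
  have [measurable]: "(ball 0 1 :: (real^'n) set) \<in> sets borel" by simp
  let ?n = "CARD('n)" and ?v = "unit_ball_vol (real CARD('n))"
  have v: "?v > 0" by simp
  have M: "emeasure ?M {a<..} = emeasure lborel ((ball 0 1 :: (real^'n) set) - cball 0 a)" for a
  proof -
    have "emeasure ?M {a<..} = emeasure (density lborel (indicator (ball 0 1))) {x :: real^'n. a < norm x}"
      by (subst emeasure_distr) (auto intro!: arg_cong2[where f=emeasure])
    also have "\<dots> = (\<integral>\<^sup>+ x. indicator (ball 0 1) x * indicator {x :: real^'n. a < norm x} x \<partial>lborel)"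
      by (subst emeasure_density) auto
    also have "\<dots> = (\<integral>\<^sup>+ x. indicator (ball 0 1 - cball 0 a) x \<partial>(lborel :: (real^'n) measure))"
      by (rule nn_integral_cong) (auto simp: indicator_def)
    also have "\<dots> = emeasure lborel ((ball 0 1 :: (real^'n) set) - cball 0 a)"
      by (rule nn_integral_indicator) simp
    finally show ?thesis .
  qed
  have N: "emeasure ?N {a<..} = (\<integral>\<^sup>+ r. ennreal (c * r ^ (?n - 1)) * indicator {max 0 a..1} r \<partial>lborel)" for a
    by (subst emeasure_density; (simp; fail)?)
      (rule nn_integral_cong_AE, use AE_lborel_singleton[of a] in \<open>auto simp: indicator_def elim!: eventually_mono\<close>)
  show "emeasure ?M {a<..} < \<infinity>" for a
  proof -
    have "emeasure ?M {a<..} \<le> emeasure lborel (ball 0 1 :: (real^'n) set)"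
      unfolding M by (intro emeasure_mono) auto
    also have "\<dots> < \<infinity>" using emeasure_lborel_ball_finite by auto
    finally show ?thesis .
  qed
  show "emeasure ?M {a<..} = emeasure ?N {a<..}" for a
  proof (cases "a < 1")
    case False
    then have e: "(ball 0 1 :: (real^'n) set) - cball 0 a = {}" by auto
    have "emeasure ?N {a<..} = 0" 
      unfolding N using False
      by (subst nn_integral_0_iff_AE) 
        (use AE_lborel_singleton[of 1] in \<open>auto simp: indicator_def elim!: eventually_mono\<close>)
    then show ?thesis unfolding M e by simp
  next
    case True
    let ?b = "max 0 a"
    have "emeasure ?N {a<..} = ennreal (?v * 1 ^ ?n - ?v * ?b ^ ?n)"
      unfolding N using True v
    proof (intro nn_integral_FTC_Icc)
      fix r :: real
      show "((\<lambda>r. ?v * r ^ ?n) has_real_derivative c * r ^ (?n - 1)) (at r)"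
        unfolding c_def by (auto intro!: derivative_eq_intros)
    qed (auto simp: c_def)
    moreover have "emeasure lborel ((ball 0 1 :: (real^'n) set) - cball 0 a) = ennreal (?v * 1 ^ ?n - ?v * ?b ^ ?n)"
    proof (cases "a < 0")
      case True
      then show ?thesis using emeasure_ball[of 1 "0 :: real^'n"] by (simp add: zero_power)
    next
      case False
      with True show ?thesis
        using emeasure_ball[of 1 "0 :: real^'n"] emeasure_cball[of a "0 :: real^'n"] v
        by (subst emeasure_Diff) (auto simp: ennreal_minus)
    qed
    ultimately show ?thesis unfolding M by simp
  qed
qed auto

lemma nn_integral_radial_ball:
  assumes [measurable]: "f \<in> borel_measurable borel"
  shows "(\<integral>\<^sup>+ x. indicator (ball 0 1) x * f (norm (x :: real^'n::finite)) \<partial>lborel)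
    = (\<integral>\<^sup>+ r. ennreal (real CARD('n) * unit_ball_vol (real CARD('n)) * r ^ (CARD('n) - 1))
         * indicator {0..1} r * f r \<partial>lborel)"
proof -
  have [measurable]: "(ball 0 1 :: (real^'n) set) \<in> sets borel" by simp
  have "(\<integral>\<^sup>+ x. indicator (ball 0 1) x * f (norm (x :: real^'n)) \<partial>lborel)
      = (\<integral>\<^sup>+ r. f r \<partial>distr (density lborel (indicator (ball 0 1))) borel (norm :: real^'n \<Rightarrow> real))"
    by (simp add: nn_integral_distr nn_integral_density)
  also have "\<dots> = (\<integral>\<^sup>+ r. ennreal (real CARD('n) * unit_ball_vol (real CARD('n)) * r ^ (CARD('n) - 1))
         * indicator {0..1} r * f r \<partial>lborel)"
    unfolding norm_distribution_ball by (subst nn_integral_density) auto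
  finally show ?thesis .
qed

text \<open>The radial density \<open>r^(n-1)\<close> is at most \<open>r\<^sup>2\<close> on the unit interval when \<open>n \<ge> 3\<close>. Both
  \<open>|V|\<close> and \<open>1 / r\<^sup>2\<close> satisfy the hypothesis, the former as \<open>r |V(r)|\<close> is integrable.\<close>

lemma integrable_radial_ball:
  fixes f :: "real \<Rightarrow> real"
  assumes dim: "CARD('n::finite) \<ge> 3" and [measurable]: "f \<in> borel_measurable borel"
    and int: "integrable lborel (\<lambda>r. indicator {0<..<1} r * (r\<^sup>2 * f r))"
  shows "integrable lborel (\<lambda>x :: real^'n. indicator (ball 0 1) x * f (norm x))"
proof (rule integrableI_bounded)
  have [measurable]: "(ball 0 1 :: (real^'n) set) \<in> sets borel" by simp
  let ?c = "real CARD('n) * unit_ball_vol (real CARD('n))"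
  have "(\<integral>\<^sup>+ x. norm (indicator (ball 0 1) x * f (norm (x :: real^'n))) \<partial>lborel)
      = (\<integral>\<^sup>+ x. indicator (ball 0 1) x * ennreal \<bar>f (norm (x :: real^'n))\<bar> \<partial>lborel)"
    by (intro nn_integral_cong) (auto simp: indicator_def)
  also have "\<dots> = (\<integral>\<^sup>+ r. ennreal (?c * r ^ (CARD('n) - 1)) * indicator {0..1} r * ennreal \<bar>f r\<bar> \<partial>lborel)"
    by (rule nn_integral_radial_ball) simp
  also have "\<dots> \<le> (\<integral>\<^sup>+ r. ennreal ?c * norm (indicator {0<..<1} r * (r\<^sup>2 * f r)) \<partial>lborel)"
  proof (rule nn_integral_mono_AE)
    show "AE r in lborel. ennreal (?c * r ^ (CARD('n) - 1)) * indicator {0..1} r * ennreal \<bar>f r\<bar>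
        \<le> ennreal ?c * norm (indicator {0<..<1} r * (r\<^sup>2 * f r))"
      using AE_lborel_singleton[of "0::real"] AE_lborel_singleton[of "1::real"]
    proof eventually_elim
      fix r :: real assume "r \<noteq> 0" "r \<noteq> 1"
      then show "ennreal (?c * r ^ (CARD('n) - 1)) * indicator {0..1} r * ennreal \<bar>f r\<bar>
        \<le> ennreal ?c * norm (indicator {0<..<1} r * (r\<^sup>2 * f r))"
      proof (cases "r \<in> {0<..<1}")
        case True
        then have "r ^ (CARD('n) - 1) \<le> r ^ 2" using dim by (intro power_decreasing) auto
        then have "?c * r ^ (CARD('n) - 1) * \<bar>f r\<bar> \<le> ?c * (r\<^sup>2 * \<bar>f r\<bar>)"
          by (auto intro!: mult_left_mono mult_right_mono simp: mult.assoc)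
        then show ?thesis using True
          by (auto simp: ennreal_mult[symmetric] abs_mult intro!: ennreal_leI)
      qed (auto simp: indicator_def)
    qed
  qed
  also have "\<dots> = ennreal ?c * (\<integral>\<^sup>+ r. norm (indicator {0<..<1} r * (r\<^sup>2 * f r)) \<partial>lborel)"
    by (rule nn_integral_cmult) measurable
  also have "\<dots> < \<infinity>"
    using int by (auto simp: integrable_iff_bounded ennreal_mult_less_top)
  finally show "(\<integral>\<^sup>+ x. norm (indicator (ball 0 1) x * f (norm (x :: real^'n))) \<partial>lborel) < \<infinity>" .
  show "(\<lambda>x :: real^'n. indicator (ball 0 1) x * f (norm x)) \<in> borel_measurable lborel"
    by simp
qed

text \<open>The preimage under the norm of a null set of radii is a null set, by polar coordinates.\<close>

lemma AE_radial_ball: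
  assumes "AE r in lborel. r \<in> {0<..<1} \<longrightarrow> P r"
  shows "AE x in lborel. x \<in> ball (0 :: real^'n::finite) 1 \<and> x \<noteq> 0 \<longrightarrow> P (norm x)"
proof -
  obtain N where N: "{r. \<not> (r \<in> {0<..<1} \<longrightarrow> P r)} \<subseteq> N" "N \<in> null_sets lborel"
    using assms by (auto elim!: AE_E simp: null_sets_def)
  have [measurable]: "(ball 0 1 :: (real^'n) set) \<in> sets borel" by simp
  have [measurable]: "N \<in> sets borel" using N by auto
  have "(\<integral>\<^sup>+ x. indicator (ball 0 1) x * indicator N (norm (x :: real^'n)) \<partial>lborel)
    = (\<integral>\<^sup>+ r. ennreal (real CARD('n) * unit_ball_vol (real CARD('n)) * r ^ (CARD('n) - 1))
         * indicator {0..1} r * indicator N r \<partial>lborel)"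
    by (rule nn_integral_radial_ball) simp
  also have "\<dots> = 0"
    using AE_not_in[OF N(2)] by (subst nn_integral_0_iff_AE) (auto elim!: eventually_mono)
  finally have "AE x in lborel. indicator (ball 0 1) x * indicator N (norm (x :: real^'n)) = (0 :: ennreal)"
    by (subst (asm) nn_integral_0_iff_AE) simp_all
  then show ?thesis
  proof (rule eventually_mono)
    fix x :: "real^'n"
    assume *: "indicator (ball 0 1) x * indicator N (norm x) = (0 :: ennreal)"
    show "x \<in> ball 0 1 \<and> x \<noteq> 0 \<longrightarrow> P (norm x)"
    proof
      assume "x \<in> ball 0 1 \<and> x \<noteq> 0"
      then have "norm x \<in> {0<..<1}" "norm x \<notin> N" using * by auto
      then show "P (norm x)" using N(1) by blast
    qed
  qed
qed


section \<open>The radial equation\<close>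

text \<open>Two normalisations: \<open>V\<close> is a Borel function on the whole line that vanishes off the unit interval, and
  \<open>N\<close> stands for \<open>2 \<ell> + 1\<close>, a natural number for the angular momenta that occur.\<close>

locale radial_potential =
  fixes V :: "real \<Rightarrow> complex" and N :: nat
  assumes V_measurable [measurable]: "V \<in> borel_measurable borel"
    and V_support: "\<And>s. s \<notin> {0<..<1} \<Longrightarrow> V s = 0"
    and V_integrable: "integrable lborel (\<lambda>s. s * norm (V s))"
    and N_pos: "N \<ge> 1"
begin

definition weight :: "real \<Rightarrow> real" where "weight s = s * norm (V s)"

definition weight_upto :: "real \<Rightarrow> real" where "weight_upto r = (\<integral>s. indicator {..r} s *\<^sub>R weight s \<partial>lborel)"

definition mass :: real where "mass = (\<integral>s. weight s \<partial>lborel)"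

text \<open>The kernel of the recursion for \<open>\<psi>\<close> after division by \<open>r powr (\<ell> + 1)\<close>. It lies
  between \<open>0\<close> and \<open>s\<close>, which makes \<open>s |V(s)|\<close> the natural majorant.\<close>

definition kernel :: "real \<Rightarrow> real \<Rightarrow> real" where
  "kernel r s = (if 0 < s \<and> s < r then s * (1 - (s / r) ^ N) / N else 0)"

primrec series_term :: "nat \<Rightarrow> real \<Rightarrow> complex" where
  "series_term 0 r = 1"
| "series_term (Suc k) r = (\<integral>s. of_real (kernel r s) * V s * series_term k s \<partial>lborel)"

definition regular :: "real \<Rightarrow> complex" where "regular r = (\<Sum>k. series_term k r)"

lemma weight_integrable: "integrable lborel weight"
  using V_integrable by (simp add: weight_def[abs_def])

lemma weight_measurable [measurable]: "weight \<in> borel_measurable borel"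
  unfolding weight_def[abs_def] by measurable

lemma weight_nonneg: "0 \<le> weight s"
  using V_support[of s] by (cases "s \<in> {0<..<1}") (auto simp: weight_def)

lemma mass_nonneg: "0 \<le> mass"
  unfolding mass_def by (intro integral_nonneg_AE) (simp add: weight_nonneg)

lemma weight_upto_nonneg: "0 \<le> weight_upto r"
  unfolding weight_upto_def by (intro integral_nonneg_AE) (simp add: weight_nonneg)

lemma weight_upto_le_mass: "weight_upto r \<le> mass"
  unfolding weight_upto_def mass_def
proof (rule integral_mono)
  show "integrable lborel (\<lambda>s. indicator {..r} s *\<^sub>R weight s)"
    by (intro integrable_mult_indicator weight_integrable) simp
qed (use weight_integrable weight_nonneg in \<open>auto simp: indicator_def\<close>)

lemma kernel_bounds: "0 \<le> kernel r s" "kernel r s \<le> \<bar>s\<bar>"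
proof -
  have "0 \<le> kernel r s \<and> kernel r s \<le> \<bar>s\<bar>"
  proof (cases "0 < s \<and> s < r")
    case True
    then have "0 \<le> (s / r) ^ N" "(s / r) ^ N \<le> 1" by (auto intro!: power_le_one)
    then have *: "0 \<le> (1 - (s / r) ^ N)" "(1 - (s / r) ^ N) \<le> 1" by auto
    have "s * (1 - (s / r) ^ N) / N \<le> s * (1 - (s / r) ^ N) / 1"
      using N_pos True * by (intro divide_left_mono) auto
    also have "\<dots> \<le> s" using * True by (simp add: mult_left_le)
    finally show ?thesis using True * by (auto simp: kernel_def)
  qed (auto simp: kernel_def)
  then show "0 \<le> kernel r s" "kernel r s \<le> \<bar>s\<bar>" by auto
qed

lemma kernel_V_bound: "norm (of_real (kernel r s) * V s) \<le> indicator {..r} s *\<^sub>R weight s"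
proof (cases "0 < s \<and> s < r")
  case True
  then have "norm (of_real (kernel r s) * V s) \<le> s * norm (V s)"
    using kernel_bounds[of r s] by (auto simp: norm_mult intro!: mult_right_mono)
  then show ?thesis using True by (simp add: weight_def)
next
  case False
  then show ?thesis using weight_nonneg[of s] by (auto simp: kernel_def)
qed

lemma kernel_V_le_weight: "norm (of_real (kernel r s) * V s) \<le> weight s"
  using kernel_V_bound[of r s] weight_nonneg[of s] by (cases "s \<le> r") auto

lemma kernel_measurable [measurable]:
  "(\<lambda>p. kernel (fst p) (snd p)) \<in> borel_measurable (borel \<Otimes>\<^sub>M borel)"
  "kernel r \<in> borel_measurable borel"
  unfolding kernel_def[abs_def] by measurable

lemma series_term_measurable [measurable]: "series_term k \<in> borel_measurable borel"
proof (induction k)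
  case (Suc k)
  note [measurable] = Suc
  have "(\<lambda>(r, s). of_real (kernel r s) * V s * series_term k s) \<in> borel_measurable (borel \<Otimes>\<^sub>M lborel)"
    unfolding split_beta by measurable
  then have "(\<lambda>r. \<integral>s. of_real (kernel r s) * V s * series_term k s \<partial>lborel) \<in> borel_measurable borel"
    by (rule lborel.borel_measurable_lebesgue_integral)
  then show ?case by (simp add: fun_eq_iff cong: measurable_cong)
qed simp

text \<open>Each step of the recursion integrates the previous bound against \<open>s |V(s)|\<close>, which is the density of
  the indefinite integral \<open>W\<close> itself; hence \<open>W^k / k!\<close> as for the exponential series.\<close>

lemma norm_series_term_le_weight_upto: "norm (series_term k r) \<le> weight_upto r ^ k / fact k"
proof (induction k arbitrary: r)
  case (Suc k)
  let ?d = "\<lambda>s. (indicator {..r} s *\<^sub>R (weight s * weight_upto s ^ k)) / fact k"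
  have d: "integrable lborel ?d"
    using integrable_mult_indicator[OF _ integral_power_indefinite(1)[OF weight_integrable, of k], of "{..r}"]
    by (simp add: weight_upto_def)
  have "norm (of_real (kernel r s) * V s * series_term k s) \<le> ?d s" for s
  proof -
    have "norm (of_real (kernel r s) * V s * series_term k s)
        \<le> (indicator {..r} s *\<^sub>R weight s) * (weight_upto s ^ k / fact k)"
      unfolding norm_mult[of "of_real (kernel r s) * V s"]
      by (intro mult_mono kernel_V_bound Suc.IH) (auto simp: weight_nonneg)
    then show ?thesis by simp
  qed
  then have "norm (series_term (Suc k) r) \<le> (\<integral>s. ?d s \<partial>lborel)"
    unfolding series_term.simps
    by (intro Bochner_Integration.integral_norm_bound_integral d Bochner_Integration.integrable_bound[OF d])
      (auto simp: weight_nonneg weight_upto_nonneg)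
  also have "\<dots> = weight_upto r ^ Suc k / (Suc k) / fact k"
    using integral_power_indefinite(2)[OF weight_integrable, where k=k and r=r] by (simp add: weight_upto_def)
  finally show ?case by (simp add: field_simps)
qed simp

lemma norm_series_term_le: "norm (series_term k r) \<le> mass ^ k / fact k"
  by (rule order_trans[OF norm_series_term_le_weight_upto])
    (intro divide_right_mono power_mono weight_upto_le_mass weight_upto_nonneg; simp)

lemma exp_series_mass: "(\<lambda>k. mass ^ k / fact k) sums exp mass"
  using exp_converges[of mass] by (simp add: divide_inverse mult.commute)

lemma summable_series_term: "summable (\<lambda>k. norm (series_term k r))" "summable (\<lambda>k. series_term k r)"
proof -
  show *: "summable (\<lambda>k. norm (series_term k r))"
    by (rule summable_comparison_test'[OF sums_summable[OF exp_series_mass], of 0])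
      (simp add: norm_series_term_le)
  show "summable (\<lambda>k. series_term k r)" by (rule summable_norm_cancel[OF *])
qed

lemma norm_regular_le: "norm (regular r) \<le> exp mass"
proof -
  have "norm (regular r) \<le> (\<Sum>k. norm (series_term k r))"
    unfolding regular_def by (rule summable_norm[OF summable_series_term(1)])
  also have "\<dots> \<le> (\<Sum>k. mass ^ k / fact k)"
    by (intro suminf_le norm_series_term_le summable_series_term sums_summable[OF exp_series_mass])
  also have "\<dots> = exp mass" using exp_series_mass by (simp add: sums_unique[symmetric])
  finally show ?thesis .
qed

lemma regular_measurable [measurable]: "regular \<in> borel_measurable borel"
  unfolding regular_def[abs_def] by measurable

text \<open>The recursion summed over \<open>k\<close>; the exponential majorant justifies exchanging sum and integral.\<close>

lemma regular_integral_equation: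
  "regular r = 1 + (\<integral>s. of_real (kernel r s) * V s * regular s \<partial>lborel)"
proof -
  let ?f = "\<lambda>k s. of_real (kernel r s) * V s * series_term k s"
  have bound: "norm (?f k s) \<le> weight s * (mass ^ k / fact k)" for k s
    unfolding norm_mult[of "of_real (kernel r s) * V s"]
    by (intro mult_mono norm_series_term_le kernel_V_le_weight) (auto simp: weight_nonneg)
  have int: "integrable lborel (?f k)" for k
    by (rule Bochner_Integration.integrable_bound[where f="\<lambda>s. weight s * (mass ^ k / fact k)"])
      (use bound[where k=k] weight_integrable mass_nonneg weight_nonneg in \<open>auto intro: order_trans\<close>)
  have summ: "summable (\<lambda>k. \<integral>s. norm (?f k s) \<partial>lborel)"
  proof (rule summable_comparison_test'[of "\<lambda>k. mass * (mass ^ k / fact k)" 0])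
    show "summable (\<lambda>k. mass * (mass ^ k / fact k))"
      by (intro summable_mult sums_summable[OF exp_series_mass])
    show "norm (\<integral>s. norm (?f k s) \<partial>lborel) \<le> mass * (mass ^ k / fact k)" for k
    proof -
      have "(\<integral>s. norm (?f k s) \<partial>lborel) \<le> (\<integral>s. weight s * (mass ^ k / fact k) \<partial>lborel)"
        by (intro integral_mono integrable_norm int bound integrable_mult_left weight_integrable)
      then show ?thesis by (simp add: mass_def)
    qed
  qed
  have "(\<integral>s. (\<Sum>k. ?f k s) \<partial>lborel) = (\<Sum>k. \<integral>s. ?f k s \<partial>lborel)"
  proof (rule integral_suminf[OF int _ summ])
    show "AE s in lborel. summable (\<lambda>k. norm (?f k s))"
      by (intro AE_I2) (simp add: norm_mult summable_mult summable_series_term)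
  qed
  moreover have "(\<Sum>k. ?f k s) = of_real (kernel r s) * V s * regular s" for s
    unfolding regular_def by (rule suminf_mult[OF summable_series_term(2)])
  moreover have "regular r = series_term 0 r + (\<Sum>k. series_term (Suc k) r)"
    unfolding regular_def using suminf_split_head[OF summable_series_term(2), of r] by simp
  ultimately show ?thesis by simp
qed

text \<open>With \<open>\<alpha>\<close> for the radial factor, the radial equation reads \<open>(r^(N+1) \<alpha>')' = r^(N+1) V \<alpha>\<close>.
  \<open>flux_density\<close> is its right-hand side, \<open>flux\<close> plays the role of \<open>r^(N+1) \<alpha>'\<close> and \<open>slope\<close> that of \<open>\<alpha>'\<close>.\<close>

definition flux_density :: "real \<Rightarrow> complex" where
  "flux_density s = of_real (s ^ Suc N) * V s * regular s"

definition flux :: "real \<Rightarrow> complex" where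
  "flux r = (\<integral>s. indicator {..r} s *\<^sub>R flux_density s \<partial>lborel)"

definition slope :: "real \<Rightarrow> complex" where
  "slope r = (if 0 < r \<and> r < 1 then flux r / of_real (r ^ Suc N) else 0)"

lemma flux_density_measurable [measurable]: "flux_density \<in> borel_measurable borel"
  unfolding flux_density_def[abs_def] by measurable

lemma norm_flux_density_le:
  assumes "s \<le> r" "0 \<le> r"
  shows "norm (flux_density s) \<le> exp mass * r ^ N * weight s"
proof (cases "s \<in> {0<..<1}")
  case True
  have "norm (flux_density s) = s ^ N * weight s * norm (regular s)"
    using True by (simp add: flux_density_def norm_mult norm_power weight_def)
  also have "\<dots> \<le> r ^ N * weight s * exp mass"
    using True assms by (intro mult_mono power_mono norm_regular_le mult_nonneg_nonneg weight_nonneg) auto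
  finally show ?thesis by (simp add: ac_simps)
next
  case False
  then show ?thesis using weight_nonneg[of s] assms V_support by (simp add: flux_density_def)
qed

lemma flux_density_outside: "s \<notin> {0<..<1} \<Longrightarrow> flux_density s = 0"
  by (simp add: flux_density_def V_support)

lemma flux_density_integrable: "integrable lborel flux_density"
proof (rule Bochner_Integration.integrable_bound)
  show "integrable lborel (\<lambda>s. exp mass * 1 ^ N * weight s)" using weight_integrable by simp
  have "norm (flux_density s) \<le> exp mass * 1 ^ N * weight s" for s
    using norm_flux_density_le[of s 1] flux_density_outside[of s] weight_nonneg[of s] by (cases "s \<le> 1") auto
  then show "AE s in lborel. norm (flux_density s) \<le> norm (exp mass * 1 ^ N * weight s)"
    using weight_nonneg by (auto intro!: AE_I2)
qed simp

lemma flux_diff: "r \<le> s \<Longrightarrow> flux s = flux r + (\<integral>u. indicator {r..s} u *\<^sub>R flux_density u \<partial>lborel)"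
  unfolding flux_def by (rule indefinite_integral_split[OF flux_density_integrable])

lemma norm_flux_le: 
  assumes "0 \<le> r"
  shows "norm (flux r) \<le> exp mass * mass * r ^ N"
proof -
  have "norm (flux r) \<le> (\<integral>s. exp mass * r ^ N * weight s \<partial>lborel)"
    unfolding flux_def
  proof (rule Bochner_Integration.integral_norm_bound_integral)
    show "integrable lborel (\<lambda>s. indicator {..r} s *\<^sub>R flux_density s)"
      by (intro integrable_mult_indicator flux_density_integrable) simp
    show "norm (indicator {..r} s *\<^sub>R flux_density s) \<le> exp mass * r ^ N * weight s" for s
      using norm_flux_density_le[of s r] assms weight_nonneg[of s] by (auto simp: indicator_def)
  qed (use weight_integrable in simp)
  then show ?thesis by (simp add: mass_def ac_simps)
qed

lemma flux_measurable [measurable]: "flux \<in> borel_measurable borel"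
  unfolding flux_def[abs_def] by (rule indefinite_integral_measurable) simp

lemma slope_measurable [measurable]: "slope \<in> borel_measurable borel"
  unfolding slope_def[abs_def] by measurable

lemma norm_slope_le:
  assumes "0 < r"
  shows "norm (slope r) \<le> exp mass * mass / r"
proof (cases "r < 1")
  case True
  then show ?thesis using norm_flux_le[of r] assms
    by (auto simp: slope_def norm_divide norm_mult norm_power field_simps)
qed (use assms mass_nonneg in \<open>simp add: slope_def\<close>)

lemma integral_inverse_power:
  assumes "0 < t" "t \<le> r"
  shows "(\<integral>s. indicator {t..r} s *\<^sub>R (1 / s ^ Suc N) \<partial>lborel) = (1 / t ^ N - 1 / r ^ N) / N"
    and "integrable lborel (\<lambda>s. indicator {t..r} s *\<^sub>R (1 / s ^ Suc N))"
proof -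
  have cont: "continuous_on {t..r} (\<lambda>s. 1 / s ^ Suc N)"
    using assms by (intro continuous_intros) auto
  show "integrable lborel (\<lambda>s. indicator {t..r} s *\<^sub>R (1 / s ^ Suc N))"
    using borel_integrable_compact[OF compact_Icc cont] by (simp add: indicator_scaleR_eq_if)
  have "(\<integral>s. indicator {t..r} s *\<^sub>R (1 / s ^ Suc N) \<partial>lborel) = - (1 / (N * r ^ N)) - - (1 / (N * t ^ N))"
  proof (rule integral_FTC_atLeastAtMost[OF assms(2) _ cont])
    fix s assume "t \<le> s" "s \<le> r"
    then have s: "s > 0" using assms by simp
    obtain M where M: "N = Suc M" using N_pos by (cases N) auto
    have "((\<lambda>s. - (1 / N) * inverse s ^ N) has_real_derivative
        - (1 / N) * (N * inverse s ^ (N - 1) * - (inverse s * inverse s))) (at s)"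
      using s by (auto intro!: derivative_eq_intros)
    moreover have "- (1 / N) * (N * inverse s ^ (N - 1) * - (inverse s * inverse s)) = 1 / s ^ Suc N"
      using s by (simp add: M field_simps)
    moreover have "(\<lambda>s::real. - (1 / N) * inverse s ^ N) = (\<lambda>s::real. - (1 / (N * s ^ N)))"
      by (auto simp: field_simps power_inverse)
    ultimately have "((\<lambda>s. - (1 / (N * s ^ N))) has_real_derivative 1 / s ^ Suc N) (at s)"
      by simp
    then show "((\<lambda>s. - (1 / (N * s ^ N))) has_vector_derivative 1 / s ^ Suc N) (at s within {t..r})"
      by (auto simp: has_real_derivative_iff_has_vector_derivative intro: has_vector_derivative_at_within)
  qed
  also have "\<dots> = (1 / t ^ N - 1 / r ^ N) / N" by (simp add: diff_divide_distrib mult.commute)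
  finally show "(\<integral>s. indicator {t..r} s *\<^sub>R (1 / s ^ Suc N) \<partial>lborel) = (1 / t ^ N - 1 / r ^ N) / N" .
qed

text \<open>For \<open>t \<le> r\<close> the kernel at \<open>(r, t)\<close> is \<open>t^(N+1)\<close> times the integral of \<open>s^(-N-1)\<close> over \<open>{t..r}\<close>. Inserting
  this into the integral equation and integrating over \<open>t\<close> first produces the flux at \<open>s\<close>.\<close>

lemma regular_eq_integral_slope:
  assumes r: "0 < r" "r \<le> 1"
  shows "integrable lborel (\<lambda>s. indicator {..r} s *\<^sub>R slope s)"
    and "regular r = 1 + (\<integral>s. indicator {..r} s *\<^sub>R slope s \<partial>lborel)"
proof -
  let ?\<phi> = "\<lambda>t s. (indicator {t..r} s *\<^sub>R (1 / s ^ Suc N)) *\<^sub>R flux_density t"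
  have inner: "(\<integral>s. indicator {t..r} s *\<^sub>R (1 / s ^ Suc N) \<partial>lborel) *\<^sub>R flux_density t
      = of_real (kernel r t) * V t * regular t" for t
  proof (cases "t \<in> {0<..<1}")
    case True
    show ?thesis
    proof (cases "t \<le> r")
      case tr: True
      have "((1 / t ^ N - 1 / r ^ N) / N) * t ^ Suc N = t * (1 - (t / r) ^ N) / N"
        using True r by (simp add: divide_simps power_divide)
      also have "\<dots> = kernel r t" using True tr r by (cases "t = r") (auto simp: kernel_def)
      finally have "((1 / t ^ N - 1 / r ^ N) / N) * t ^ Suc N = kernel r t" .
      then have K: "of_real ((1 / t ^ N - 1 / r ^ N) / N) * of_real (t ^ Suc N) = (of_real (kernel r t) :: complex)"
        by (simp only: of_real_mult[symmetric])
      have "(\<integral>s. indicator {t..r} s *\<^sub>R (1 / s ^ Suc N) \<partial>lborel) = (1 / t ^ N - 1 / r ^ N) / N"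
        using integral_inverse_power(1)[of t r] True tr by simp
      then show ?thesis
        by (simp only: flux_density_def scaleR_conv_of_real mult.assoc[symmetric] K)
    next
      case False
      then show ?thesis by (simp add: kernel_def)
    qed
  qed (simp add: flux_density_outside V_support)
  have pair: "integrable (lborel \<Otimes>\<^sub>M lborel) (\<lambda>(t, s). ?\<phi> t s)"
  proof (rule lborel_pair.Fubini_integrable)
    have "(\<lambda>p. if fst p \<le> snd p \<and> snd p \<le> r then (1 / snd p ^ Suc N) *\<^sub>R flux_density (fst p) else 0)
      \<in> borel_measurable (lborel \<Otimes>\<^sub>M lborel)" by measurable
    then show "(\<lambda>(t, s). ?\<phi> t s) \<in> borel_measurable (lborel \<Otimes>\<^sub>M lborel)"
      by (rule back_subst[where P="\<lambda>h. h \<in> _"]) (auto simp: fun_eq_iff)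
    have "(\<integral>s. norm (?\<phi> t s) \<partial>lborel) = norm (of_real (kernel r t) * V t * regular t)" for t
    proof (cases "t \<in> {0<..<1}")
      case True
      have nn: "norm (?\<phi> t s) = (indicator {t..r} s *\<^sub>R (1 / s ^ Suc N)) * norm (flux_density t)" for s
        using True by (auto simp: indicator_def)
      have nn2: "0 \<le> (\<integral>s. indicator {t..r} s *\<^sub>R (1 / s ^ Suc N) \<partial>lborel)"
        using True by (intro integral_nonneg_AE AE_I2) (auto simp: indicator_def)
      have "(\<integral>s. norm (?\<phi> t s) \<partial>lborel)
          = (\<integral>s. indicator {t..r} s *\<^sub>R (1 / s ^ Suc N) \<partial>lborel) * norm (flux_density t)"
        unfolding nn by (rule integral_mult_left_zero)
      then show ?thesis unfolding inner[symmetric] norm_scaleR abs_of_nonneg[OF nn2] .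
    qed (simp add: flux_density_outside V_support)
    moreover have "integrable lborel (\<lambda>t. norm (of_real (kernel r t) * V t * regular t))"
    proof (rule Bochner_Integration.integrable_bound)
      show "integrable lborel (\<lambda>t. weight t * exp mass)" using weight_integrable by simp
      have "norm (of_real (kernel r t) * V t * regular t) \<le> weight t * exp mass" for t
        unfolding norm_mult[of "of_real (kernel r t) * V t"]
        by (intro mult_mono norm_regular_le kernel_V_le_weight) (auto simp: weight_nonneg)
      then show "AE t in lborel. norm (norm (of_real (kernel r t) * V t * regular t)) \<le> norm (weight t * exp mass)"
        using weight_nonneg by (auto intro!: AE_I2)
    qed simp
    ultimately show "integrable lborel (\<lambda>t. \<integral>s. norm (case (t, s) of (t, s) \<Rightarrow> ?\<phi> t s) \<partial>lborel)"
      by simp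
    have "integrable lborel (?\<phi> t)" for t
    proof (cases "t \<in> {0<..<1} \<and> t \<le> r")
      case True
      then show ?thesis using integral_inverse_power(2)[of t r] by (intro integrable_scaleR_left) auto
    qed (auto simp: flux_density_outside)
    then show "AE t in lborel. integrable lborel (\<lambda>s. case (t, s) of (t, s) \<Rightarrow> ?\<phi> t s)" by simp
  qed
  \<comment> \<open>at \<open>s = 1\<close> the slope is \<open>0\<close> by convention, so the identity can fail there\<close>
  have outer: "(\<integral>t. ?\<phi> t s \<partial>lborel) = indicator {..r} s *\<^sub>R slope s" if "s \<noteq> 1" for s
  proof (cases "0 < s \<and> s \<le> r")
    case True
    have "(\<integral>t. ?\<phi> t s \<partial>lborel) = (\<integral>t. (1 / s ^ Suc N) *\<^sub>R (indicator {..s} t *\<^sub>R flux_density t) \<partial>lborel)"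
      using True by (intro Bochner_Integration.integral_cong) (auto simp: indicator_def)
    also have "\<dots> = (1 / s ^ Suc N) *\<^sub>R flux s" by (simp only: integral_scaleR_right flux_def)
    also have "\<dots> = indicator {..r} s *\<^sub>R slope s"
      using True that r by (simp add: slope_def scaleR_conv_of_real)
    finally show ?thesis .
  next
    case False
    then have z: "?\<phi> t s = 0" for t using flux_density_outside[of t] by (cases "t \<le> 0") (auto simp: indicator_def)
    have "(\<integral>t. ?\<phi> t s \<partial>lborel) = 0" by (simp only: z Bochner_Integration.integral_zero)
    then show ?thesis using False by (auto simp: slope_def indicator_def)
  qed
  have AE: "AE s in lborel. (\<integral>t. ?\<phi> t s \<partial>lborel) = indicator {..r} s *\<^sub>R slope s"
    using AE_lborel_singleton[of "1::real"] by eventually_elim (rule outer)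
  have int: "integrable lborel (\<lambda>s. \<integral>t. ?\<phi> t s \<partial>lborel)"
    by (rule lborel_pair.integrable_snd[OF pair])
  show "integrable lborel (\<lambda>s. indicator {..r} s *\<^sub>R slope s)"
    by (rule integrable_cong_AE_imp[OF int]) (use AE in \<open>auto elim: eventually_mono\<close>)
  have "(\<integral>s. indicator {..r} s *\<^sub>R slope s \<partial>lborel) = (\<integral>s. (\<integral>t. ?\<phi> t s \<partial>lborel) \<partial>lborel)"
    by (rule integral_cong_AE) (use AE int in \<open>auto elim: eventually_mono\<close>)
  also have "\<dots> = (\<integral>t. (\<integral>s. ?\<phi> t s \<partial>lborel) \<partial>lborel)"
    by (rule lborel_pair.Fubini_integral[OF pair])
  also have "\<dots> = (\<integral>t. of_real (kernel r t) * V t * regular t \<partial>lborel)"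
  proof (rule Bochner_Integration.integral_cong[OF refl])
    fix t
    have "integrable lborel (\<lambda>s. indicator {t..r} s *\<^sub>R (1 / s ^ Suc N))" if "flux_density t \<noteq> 0"
      using that flux_density_outside[of t] integral_inverse_power(2)[of t r] by (cases "t \<le> r") auto
    then show "(\<integral>s. ?\<phi> t s \<partial>lborel) = of_real (kernel r t) * V t * regular t"
      unfolding inner[symmetric] by (rule integral_scaleR_left)
  qed
  finally show "regular r = 1 + (\<integral>s. indicator {..r} s *\<^sub>R slope s \<partial>lborel)"
    using regular_integral_equation[of r] by simp
qed

lemma slope_integrable: "integrable lborel slope"
proof -
  have "(\<lambda>s. indicator {..1} s *\<^sub>R slope s) = slope" by (auto simp: fun_eq_iff indicator_def slope_def)
  then show ?thesis using regular_eq_integral_slope(1)[of 1] by simp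
qed

end


section \<open>Test functions\<close>

lemma has_partial_partial:
  assumes "f differentiable (at x)"
  shows "has_partial f (partial j f x) j x"
proof -
  have "(f has_derivative frechet_derivative f (at (x + 0 *\<^sub>R axis j 1))) (at (x + 0 *\<^sub>R axis j 1))"
    using assms by (simp add: frechet_derivative_works[symmetric])
  moreover have "((\<lambda>t. x + t *\<^sub>R axis j 1) has_derivative (\<lambda>t. t *\<^sub>R axis j 1)) (at 0)"
    by (auto intro!: derivative_eq_intros)
  ultimately have "((\<lambda>t. f (x + t *\<^sub>R axis j 1)) has_derivative
      (\<lambda>t. frechet_derivative f (at (x + 0 *\<^sub>R axis j 1)) (t *\<^sub>R axis j 1))) (at 0)"
    using has_derivative_compose[where g = f] by blast
  then show ?thesis
    using linear_frechet_derivative[OF assms]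
    by (simp add: has_partial_def has_vector_derivative_def partial_def linear_cmul)
qed

lemma smooth_differentiable: "smooth f \<Longrightarrow> f differentiable (at x)"
  unfolding smooth_def by (metis partials_def foldr.simps(1) id_apply)

lemma smooth_partial: "smooth f \<Longrightarrow> smooth (partial j f)"
proof -
  have "partials js (partial j f) = partials (js @ [j]) f" for js
    by (simp add: partials_def)
  then show "smooth f \<Longrightarrow> smooth (partial j f)" by (simp add: smooth_def)
qed

lemma smooth_continuous: "smooth f \<Longrightarrow> continuous_on S f"
  using smooth_differentiable differentiable_imp_continuous_within continuous_at_imp_continuous_on by blast

text \<open>The complement of the closed support is open, so \<open>f\<close> vanishes in a neighbourhood of \<open>x\<close>.\<close>

lemma partial_eq_zero_off_support:
  assumes "x \<notin> closure {y. f y \<noteq> 0}"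
  shows "partial j f x = 0"
proof -
  have "((\<lambda>_. 0 :: complex) has_derivative (\<lambda>_. 0)) (at x)" by simp
  then have "(f has_derivative (\<lambda>_. 0)) (at x)"
    by (rule has_derivative_transform_within_open[where s = "- closure {y. f y \<noteq> 0}"])
      (use assms closure_subset[of "{y. f y \<noteq> 0}"] in auto)
  then show ?thesis using frechet_derivative_at[of f "\<lambda>_. 0" x] by (metis partial_def)
qed

lemma support_partial_subset: "closure {x. partial j f x \<noteq> 0} \<subseteq> closure {x. f x \<noteq> 0}"
  using partial_eq_zero_off_support[of _ f j] by (intro closure_minimal) auto

lemma test_function_partial:
  assumes "\<phi> \<in> test_functions \<Omega>"
  shows "partial j \<phi> \<in> test_functions \<Omega>"
proof -
  have "compact (closure {x. partial j \<phi> x \<noteq> 0})"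
    using assms support_partial_subset[of j \<phi>]
    by (auto simp: test_functions_def compact_eq_bounded_closed intro: bounded_subset)
  then show ?thesis
    using assms support_partial_subset[of j \<phi>] smooth_partial by (auto simp: test_functions_def)
qed

lemma test_function_partials: "\<phi> \<in> test_functions \<Omega> \<Longrightarrow> partials js \<phi> \<in> test_functions \<Omega>"
  by (induction js) (auto simp: partials_def test_function_partial)

lemma test_functions_mono: "\<Omega>' \<subseteq> \<Omega> \<Longrightarrow> test_functions \<Omega>' \<subseteq> test_functions \<Omega>"
  by (auto simp: test_functions_def)

lemma test_function_outside: "\<phi> \<in> test_functions \<Omega> \<Longrightarrow> x \<notin> \<Omega> \<Longrightarrow> \<phi> x = 0"
  using closure_subset[of "{x. \<phi> x \<noteq> 0}"] by (auto simp: test_functions_def)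

lemma test_function_continuous: "\<phi> \<in> test_functions \<Omega> \<Longrightarrow> continuous_on S \<phi>"
  by (simp add: test_functions_def smooth_continuous)

lemma test_function_measurable: "\<phi> \<in> test_functions \<Omega> \<Longrightarrow> \<phi> \<in> borel_measurable borel"
  by (intro borel_measurable_continuous_onI test_function_continuous)

lemma test_function_has_partial: "\<phi> \<in> test_functions \<Omega> \<Longrightarrow> has_partial \<phi> (partial j \<phi> x) j x"
  by (intro has_partial_partial smooth_differentiable) (simp add: test_functions_def)

lemma test_function_bounded:
  assumes "\<phi> \<in> test_functions \<Omega>"
  obtains B where "B \<ge> 0" "\<And>x. norm (\<phi> x) \<le> B"
proof -
  let ?K = "closure {x. \<phi> x \<noteq> 0}"
  have "compact (\<phi> ` ?K)"
    using assms by (intro compact_continuous_image test_function_continuous) (auto simp: test_functions_def)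
  then obtain B where B: "\<And>x. x \<in> ?K \<Longrightarrow> norm (\<phi> x) \<le> B" "B > 0"
    using bounded_normE[OF compact_imp_bounded] by (metis imageI bounded_pos compact_imp_bounded)
  have "norm (\<phi> x) \<le> B" for x
    using B(1)[of x] B(2) closure_subset[of "{x. \<phi> x \<noteq> 0}"] by (cases "\<phi> x = 0") auto
  with B(2) show thesis using that[of B] by simp
qed

section \<open>Weak derivatives\<close>

lemma integral_lebesgue_on:
  fixes f :: "'a::euclidean_space \<Rightarrow> 'b::{banach,second_countable_topology}"
  assumes "S \<in> sets lebesgue"
  shows "integral\<^sup>L (lebesgue_on S) f = (\<integral>x. indicator S x *\<^sub>R f x \<partial>lebesgue)"
    and "integrable (lebesgue_on S) f \<longleftrightarrow> integrable lebesgue (\<lambda>x. indicator S x *\<^sub>R f x)"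
  using assms by (simp_all add: integral_restrict_space integrable_restrict_space)

lemma integral_lebesgue_on_borel:
  fixes f :: "'a::euclidean_space \<Rightarrow> 'b::{banach,second_countable_topology}"
  assumes [measurable]: "S \<in> sets borel" "f \<in> borel_measurable borel"
  shows "integral\<^sup>L (lebesgue_on S) f = (\<integral>x. indicator S x *\<^sub>R f x \<partial>lborel)"
    and "integrable (lebesgue_on S) f \<longleftrightarrow> integrable lborel (\<lambda>x. indicator S x *\<^sub>R f x)"
  by (simp_all add: integral_lebesgue_on integral_completion integrable_completion)

lemma integrable_lebesgue_spike:
  fixes f g :: "'a::euclidean_space \<Rightarrow> 'b::euclidean_space"
  assumes "AE x in lebesgue. f x = g x" "integrable lebesgue f"
  shows "integrable lebesgue g"
  using assms borel_measurable_AE[OF borel_measurable_integrable[OF assms(2)] assms(1)]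
  by (auto intro: integrable_cong_AE_imp elim: eventually_mono)

text \<open>As Lebesgue measure is complete, a function that agrees almost everywhere with a non-integrable one is
  non-integrable too, and then both integrals are \<open>0\<close>.\<close>

lemma integral_lebesgue_spike:
  fixes f g :: "'a::euclidean_space \<Rightarrow> 'b::euclidean_space"
  assumes eq: "AE x in lebesgue. f x = g x"
  shows "integral\<^sup>L lebesgue f = integral\<^sup>L lebesgue g"
proof (cases "integrable lebesgue f")
  case True
  then show ?thesis
    using integrable_lebesgue_spike[OF eq True] eq by (intro integral_cong_AE) auto
next
  case False
  have "AE x in lebesgue. g x = f x" using eq by (auto elim: eventually_mono)
  then have "\<not> integrable lebesgue g" using False integrable_lebesgue_spike by blast
  with False show ?thesis by (simp add: not_integrable_integral_eq)
qed

lemma integrable_lebesgue_on_subset: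
  fixes f :: "'a::euclidean_space \<Rightarrow> 'b::{banach,second_countable_topology}"
  assumes "integrable (lebesgue_on S) f" "S \<in> sets lebesgue" "T \<in> sets lebesgue" "T \<subseteq> S"
  shows "integrable (lebesgue_on T) f"
  using assms set_integrable_subset[of lebesgue S f T]
  by (simp add: integral_lebesgue_on set_integrable_def)

lemma compact_sets_lebesgue: "compact K \<Longrightarrow> K \<in> sets lebesgue"
  by (simp add: borel_compact)

lemma integrable_imp_locally_integrable:
  assumes "integrable (lebesgue_on \<Omega>) f" "\<Omega> \<in> sets lebesgue"
  shows "locally_integrable \<Omega> f"
  unfolding locally_integrable_def
  using integrable_lebesgue_on_subset[OF assms compact_sets_lebesgue] by auto

text \<open>On the compact support of \<open>\<phi>\<close> the function \<open>u\<close> is integrable and \<open>\<phi>\<close> is bounded.\<close>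

lemma integrable_mult_test_function:
  assumes u: "locally_integrable \<Omega> u" and \<phi>: "\<phi> \<in> test_functions \<Omega>" and \<Omega>: "\<Omega> \<in> sets lebesgue"
  shows "integrable (lebesgue_on \<Omega>) (\<lambda>x. u x * \<phi> x)"
proof -
  let ?K = "closure {x. \<phi> x \<noteq> 0}"
  have K: "compact ?K" "?K \<subseteq> \<Omega>" using \<phi> by (auto simp: test_functions_def)
  have [measurable]: "\<phi> \<in> borel_measurable lebesgue"
    using test_function_measurable[OF \<phi>] by (simp add: measurable_completion)
  obtain B where B: "B \<ge> 0" "\<And>x. norm (\<phi> x) \<le> B" by (rule test_function_bounded[OF \<phi>]) blast
  have uK: "integrable lebesgue (\<lambda>x. indicator ?K x *\<^sub>R u x)"
    using u K by (simp add: locally_integrable_def integral_lebesgue_on borel_compact)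
  have "integrable lebesgue (\<lambda>x. (indicator ?K x *\<^sub>R u x) * \<phi> x)"
  proof (rule Bochner_Integration.integrable_bound[OF integrable_mult_right[OF uK, of "of_real B"]])
    show "(\<lambda>x. (indicator ?K x *\<^sub>R u x) * \<phi> x) \<in> borel_measurable lebesgue"
      using borel_measurable_integrable[OF uK] by (intro borel_measurable_times) auto
    have "norm ((indicator ?K x *\<^sub>R u x) * \<phi> x) \<le> B * norm (indicator ?K x *\<^sub>R u x)" for x
      unfolding norm_mult using B(2)[of x] by (subst mult.commute) (intro mult_right_mono; simp)
    then show "AE x in lebesgue. norm ((indicator ?K x *\<^sub>R u x) * \<phi> x)
        \<le> norm (of_real B * (indicator ?K x *\<^sub>R u x))"
      unfolding norm_mult[of "of_real B"] norm_of_real abs_of_nonneg[OF B(1)] by (rule AE_I2)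
  qed
  moreover have "(\<lambda>x. (indicator ?K x *\<^sub>R u x) * \<phi> x) = (\<lambda>x. indicator \<Omega> x *\<^sub>R (u x * \<phi> x))"
    using K(2) closure_subset[of "{x. \<phi> x \<noteq> 0}"] by (fastforce simp: fun_eq_iff indicator_def)
  ultimately show ?thesis using \<Omega> by (simp add: integral_lebesgue_on)
qed

lemma weak_deriv_Nil: "locally_integrable \<Omega> u \<Longrightarrow> weak_deriv \<Omega> [] u u"
  by (simp add: weak_deriv_def partials_def)

text \<open>The derivative nearest to the test function is taken off last: \<open>\<partial>_j \<phi>\<close> is again a test function.\<close>

lemma weak_deriv_trans:
  assumes "weak_deriv \<Omega> [i] u v" "weak_deriv \<Omega> [j] v g"
  shows "weak_deriv \<Omega> [i, j] u g"
  using assms test_function_partial[of _ \<Omega> j]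
  by (auto simp: weak_deriv_def partials_def)

lemma weak_deriv_add:
  assumes u: "weak_deriv \<Omega> js u1 g1" "weak_deriv \<Omega> js u2 g2" and \<Omega>: "\<Omega> \<in> sets lebesgue"
  shows "weak_deriv \<Omega> js (\<lambda>x. u1 x + u2 x) (\<lambda>x. g1 x + g2 x)"
  unfolding weak_deriv_def
proof (intro conjI ballI)
  fix \<phi> assume \<phi>: "\<phi> \<in> test_functions \<Omega>"
  note int = integrable_mult_test_function[OF _ _ \<Omega>]
  have I: "integrable (lebesgue_on \<Omega>) (\<lambda>x. u1 x * partials js \<phi> x)" "integrable (lebesgue_on \<Omega>) (\<lambda>x. g1 x * \<phi> x)"
     "integrable (lebesgue_on \<Omega>) (\<lambda>x. u2 x * partials js \<phi> x)" "integrable (lebesgue_on \<Omega>) (\<lambda>x. g2 x * \<phi> x)"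
    using u \<phi> by (auto simp: weak_deriv_def intro!: int test_function_partials)
  show "(LINT x|lebesgue_on \<Omega>. (u1 x + u2 x) * partials js \<phi> x)
      = (- 1) ^ length js * (LINT x|lebesgue_on \<Omega>. (g1 x + g2 x) * \<phi> x)"
    using u \<phi> I by (simp add: weak_deriv_def distrib_right distrib_left)
qed (use u in \<open>auto simp: weak_deriv_def locally_integrable_def\<close>)

lemma weak_deriv_mono:
  assumes u: "weak_deriv \<Omega> js u g" and sub: "\<Omega>' \<subseteq> \<Omega>" and sets: "\<Omega> \<in> sets lebesgue" "\<Omega>' \<in> sets lebesgue"
  shows "weak_deriv \<Omega>' js u g"
  unfolding weak_deriv_def
proof (intro conjI ballI)
  fix \<phi> assume \<phi>: "\<phi> \<in> test_functions \<Omega>'"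
  have ind: "(LINT x|lebesgue_on \<Omega>'. f x * \<psi> x) = (LINT x|lebesgue_on \<Omega>. f x * \<psi> x)"
    if "\<psi> \<in> test_functions \<Omega>'" for f \<psi>
    using sets sub test_function_outside[OF that] unfolding integral_lebesgue_on(1)[OF sets(1)] integral_lebesgue_on(1)[OF sets(2)]
    by (intro Bochner_Integration.integral_cong) (auto simp: indicator_def)
  have \<phi>': "\<phi> \<in> test_functions \<Omega>" using test_functions_mono[OF sub] \<phi> by auto
  show "(LINT x|lebesgue_on \<Omega>'. u x * partials js \<phi> x)
      = (- 1) ^ length js * (LINT x|lebesgue_on \<Omega>'. g x * \<phi> x)"
    unfolding ind[OF test_function_partials[OF \<phi>]] ind[OF \<phi>]
    using u \<phi>' by (simp add: weak_deriv_def)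
qed (use u sub in \<open>auto simp: weak_deriv_def locally_integrable_def\<close>)

lemma locally_integrable_spike:
  assumes u: "locally_integrable \<Omega> u" and eq: "AE x in lebesgue. x \<in> \<Omega> \<longrightarrow> u x = u' x"
  shows "locally_integrable \<Omega> u'"
  unfolding locally_integrable_def
proof (intro allI impI)
  fix K assume K: "compact K \<and> K \<subseteq> \<Omega>"
  then have Ks: "K \<in> sets lebesgue" by (simp add: compact_sets_lebesgue)
  have "integrable (lebesgue_on K) u" using u K by (simp add: locally_integrable_def)
  then have "integrable lebesgue (\<lambda>x. indicator K x *\<^sub>R u x)"
    using Ks by (simp add: integral_lebesgue_on)
  then have "integrable lebesgue (\<lambda>x. indicator K x *\<^sub>R u' x)"
    using eq K by (elim integrable_lebesgue_spike[rotated]) (auto elim!: eventually_mono simp: indicator_def)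
  then show "integrable (lebesgue_on K) u'" using Ks by (simp add: integral_lebesgue_on)
qed

lemma weak_deriv_spike:
  fixes u u' g g' :: "real^'a::finite \<Rightarrow> complex"
  assumes u: "weak_deriv \<Omega> js u g" and \<Omega>: "\<Omega> \<in> sets lebesgue"
    and eq: "AE x in lebesgue. x \<in> \<Omega> \<longrightarrow> u x = u' x" "AE x in lebesgue. x \<in> \<Omega> \<longrightarrow> g x = g' x"
  shows "weak_deriv \<Omega> js u' g'"
  unfolding weak_deriv_def
proof (intro conjI ballI)
  show "locally_integrable \<Omega> u'" "locally_integrable \<Omega> g'"
    using u eq by (auto simp: weak_deriv_def intro: locally_integrable_spike)
  fix \<phi> assume \<phi>: "\<phi> \<in> test_functions \<Omega>"
  have spike: "(LINT x|lebesgue_on \<Omega>. k x * \<psi> x) = (LINT x|lebesgue_on \<Omega>. k' x * \<psi> x)"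
    if "AE x in lebesgue. x \<in> \<Omega> \<longrightarrow> k x = k' x" for k k' \<psi> :: "real^'a \<Rightarrow> complex"
    unfolding integral_lebesgue_on(1)[OF \<Omega>]
    using that by (intro integral_lebesgue_spike) (auto elim!: eventually_mono simp: indicator_def)
  show "(LINT x|lebesgue_on \<Omega>. u' x * partials js \<phi> x)
      = (- 1) ^ length js * (LINT x|lebesgue_on \<Omega>. g' x * \<phi> x)"
    using u \<phi> spike[OF eq(1), of "partials js \<phi>"] spike[OF eq(2), of \<phi>] by (simp add: weak_deriv_def)
qed

section \<open>Weak derivatives of a radial factor times a smooth one\<close>

lemma has_partial_mult:
  assumes "has_partial f f' j x" "has_partial g g' j x"
  shows "has_partial (\<lambda>x. f x * g x) (f x * g' + f' * g x) j x"
  using has_vector_derivative_mult[OF assms[unfolded has_partial_def]] by (simp add: has_partial_def)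

lemma borel_measurable_continuous_off_zero:
  fixes f :: "'a::euclidean_space \<Rightarrow> complex"
  assumes "continuous_on (- {0}) f"
  shows "f \<in> borel_measurable borel"
proof -
  have "(\<lambda>x. if x \<in> - {0} then f x else f 0) \<in> borel_measurable borel"
    by (rule borel_measurable_continuous_on_if) (use assms in \<open>auto simp: borel_open\<close>)
  then show ?thesis by (rule back_subst[where P="\<lambda>h. h \<in> _"]) auto
qed

text \<open>Integration by parts with \<open>h = f \<phi>\<close>, whose derivative \<open>f \<partial>_j \<phi> + f' \<phi>\<close> separates the two sides of
  the weak derivative identity. The common majorant \<open>M\<close> supplies the integrability, also near the
  origin, where \<open>f\<close> may be singular.\<close>

lemma weak_deriv_radial_times:
  fixes f f' :: "real^'n::finite \<Rightarrow> complex" and g \<Gamma> :: "real \<Rightarrow> complex" and M :: "real^'n \<Rightarrow> real"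
  assumes dim: "CARD('n) \<ge> 2"
    and g: "integrable lborel g"
    and \<Gamma>: "\<And>r s. r \<le> s \<Longrightarrow> \<Gamma> s = \<Gamma> r + (\<integral>u. indicator {r..s} u *\<^sub>R g u \<partial>lborel)"
    and \<Gamma>_borel [measurable]: "\<Gamma> \<in> borel_measurable borel"
    and f: "\<And>x. x \<noteq> 0 \<Longrightarrow> has_partial f (f' x) j x"
    and cf: "continuous_on (- {0}) f" and cf': "continuous_on (- {0}) f'"
    and M: "integrable lborel (\<lambda>x. indicator (ball 0 1) x * M x)"
    and bounds: "\<And>x. 0 < norm x \<Longrightarrow> norm x < 1 \<Longrightarrow> norm (\<Gamma> (norm x) * f x) \<le> M x"
      "\<And>x. 0 < norm x \<Longrightarrow> norm x < 1 \<Longrightarrow> norm (g (norm x) * f x) \<le> M x"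
      "\<And>x. 0 < norm x \<Longrightarrow> norm x < 1 \<Longrightarrow> norm (\<Gamma> (norm x) * f' x) \<le> M x"
  shows "weak_deriv (ball 0 1) [j] (\<lambda>x. \<Gamma> (norm x) * f x)
      (\<lambda>x. g (norm x) * of_real (x $ j / norm x) * f x + \<Gamma> (norm x) * f' x)"
    and "integrable (lebesgue_on (ball 0 1)) (\<lambda>x. \<Gamma> (norm x) * f x)"
    and "integrable (lebesgue_on (ball 0 1)) (\<lambda>x. g (norm x) * of_real (x $ j / norm x) * f x + \<Gamma> (norm x) * f' x)"
proof -
  have [measurable]: "g \<in> borel_measurable borel" using g by auto
  have [measurable]: "f \<in> borel_measurable borel" "f' \<in> borel_measurable borel"
    using cf cf' by (auto intro: borel_measurable_continuous_off_zero)
  have [measurable]: "(ball 0 1 :: (real^'n) set) \<in> sets borel" by simp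
  have dominated: "integrable (lebesgue_on (ball 0 1)) k"
    if [measurable]: "k \<in> borel_measurable borel"
      and k: "\<And>x. 0 < norm x \<Longrightarrow> norm x < 1 \<Longrightarrow> norm (k x) \<le> C * M x" for k :: "real^'n \<Rightarrow> complex" and C
  proof -
    have "integrable lborel (\<lambda>x. indicator (ball 0 1) x *\<^sub>R k x)"
    proof (rule Bochner_Integration.integrable_bound[OF integrable_mult_right[OF M, of C]])
      show "AE x in lborel. norm (indicator (ball 0 1) x *\<^sub>R k x) \<le> norm (C * (indicator (ball 0 1) x * M x))"
        using AE_lborel_singleton[of "0 :: real^'n"]
      proof eventually_elim
        fix x :: "real^'n" assume "x \<noteq> 0"
        then show "norm (indicator (ball 0 1) x *\<^sub>R k x) \<le> norm (C * (indicator (ball 0 1) x * M x))"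
          using k[of x] by (cases "x \<in> ball 0 1") auto
      qed
    qed simp
    then show ?thesis by (subst integral_lebesgue_on_borel(2)) simp_all
  qed
  have to_lborel: "integrable lborel k" "integral\<^sup>L (lebesgue_on (ball 0 1)) k = integral\<^sup>L lborel k"
    if "integrable (lebesgue_on (ball 0 1)) k" and k: "k \<in> borel_measurable borel"
      and 0: "\<And>x. x \<notin> ball 0 1 \<Longrightarrow> k x = 0" for k :: "real^'n \<Rightarrow> complex"
  proof -
    have "(\<lambda>x. indicator (ball 0 1) x *\<^sub>R k x) = k" using 0 by (auto simp: fun_eq_iff indicator_def)
    then show "integrable lborel k" "integral\<^sup>L (lebesgue_on (ball 0 1)) k = integral\<^sup>L lborel k"
      using that(1) integral_lebesgue_on_borel[of "ball 0 1", OF _ k] by simp_all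
  qed
  have r1: "norm (of_real (x $ j / norm x) :: complex) \<le> 1" for x :: "real^'n"
    using component_le_norm_cart[of x j] by (cases "x = 0") (auto simp: norm_divide divide_le_eq)
  let ?u = "\<lambda>x. \<Gamma> (norm x) * f x"
  let ?v = "\<lambda>x. g (norm x) * of_real (x $ j / norm x) * f x + \<Gamma> (norm x) * f' x"
  have u_bound: "norm (?u x) \<le> 1 * M x" if "0 < norm x" "norm x < 1" for x
    using bounds(1)[OF that] by simp
  have gx: "norm (g (norm x) * of_real (x $ j / norm x) * f x) \<le> M x" if "0 < norm x" "norm x < 1" for x
  proof -
    have "norm (g (norm x) * of_real (x $ j / norm x) * f x)
        = norm (of_real (x $ j / norm x) :: complex) * norm (g (norm x) * f x)"
      by (simp add: norm_mult norm_divide)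
    also have "\<dots> \<le> 1 * M x" by (intro mult_mono r1 bounds that) auto
    finally show ?thesis by simp
  qed
  have v_bound: "norm (?v x) \<le> 2 * M x" if "0 < norm x" "norm x < 1" for x
    using gx[OF that] bounds(3)[OF that] norm_triangle_ineq[of "g (norm x) * of_real (x $ j / norm x) * f x" "\<Gamma> (norm x) * f' x"]
    by simp
  show u_int: "integrable (lebesgue_on (ball 0 1)) ?u" by (rule dominated[OF _ u_bound]) simp
  show v_int: "integrable (lebesgue_on (ball 0 1)) ?v" by (rule dominated[OF _ v_bound]) simp
  show "weak_deriv (ball 0 1) [j] ?u ?v"
    unfolding weak_deriv_def
  proof (intro conjI ballI)
    show "locally_integrable (ball 0 1) ?u" "locally_integrable (ball 0 1) ?v"
      using u_int v_int by (auto intro: integrable_imp_locally_integrable)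
    fix \<phi> :: "real^'n \<Rightarrow> complex" assume \<phi>: "\<phi> \<in> test_functions (ball 0 1)"
    note \<phi>' = test_function_partial[OF \<phi>, of j]
    note [measurable] = test_function_measurable[OF \<phi>] test_function_measurable[OF \<phi>']
    let ?A = "\<lambda>x. ?u x * partial j \<phi> x" and ?B = "\<lambda>x. ?v x * \<phi> x"
    have A: "integrable (lebesgue_on (ball 0 1)) ?A" and B: "integrable (lebesgue_on (ball 0 1)) ?B"
      using \<phi> \<phi>' u_int v_int by (auto intro!: integrable_mult_test_function integrable_imp_locally_integrable)
    have C: "integrable (lebesgue_on (ball 0 1)) (\<lambda>x. ?u x * \<phi> x)"
      using \<phi> u_int by (auto intro!: integrable_mult_test_function integrable_imp_locally_integrable)
    have A': "integrable lborel ?A" "integral\<^sup>L (lebesgue_on (ball 0 1)) ?A = integral\<^sup>L lborel ?A"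
      by (rule to_lborel[OF A]; simp add: test_function_outside[OF \<phi>'])+
    have B': "integrable lborel ?B" "integral\<^sup>L (lebesgue_on (ball 0 1)) ?B = integral\<^sup>L lborel ?B"
      by (rule to_lborel[OF B]; simp add: test_function_outside[OF \<phi>])+
    have C': "integrable lborel (\<lambda>x. ?u x * \<phi> x)"
      by (rule to_lborel[OF C]; simp add: test_function_outside[OF \<phi>])
    have "(\<integral>x. g (norm x) * of_real (x $ j / norm x) * (f x * \<phi> x)
        + \<Gamma> (norm x) * (f x * partial j \<phi> x + f' x * \<phi> x) \<partial>lborel) = 0"
    proof (rule radial_integration_by_parts[OF dim g \<Gamma>])
      show "has_partial (\<lambda>x. f x * \<phi> x) (f x * partial j \<phi> x + f' x * \<phi> x) j x" if "x \<noteq> 0" for x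
        by (intro has_partial_mult f that test_function_has_partial[OF \<phi>])
      show "continuous_on (- {0}) (\<lambda>x. f x * partial j \<phi> x + f' x * \<phi> x)"
        by (intro continuous_intros cf cf' test_function_continuous[OF \<phi>] test_function_continuous[OF \<phi>'])
      show "integrable lborel (\<lambda>x. \<Gamma> (norm x) * (f x * \<phi> x))" using C' by (simp add: mult.assoc)
      show "integrable lborel (\<lambda>x. g (norm x) * of_real (x $ j / norm x) * (f x * \<phi> x)
          + \<Gamma> (norm x) * (f x * partial j \<phi> x + f' x * \<phi> x))"
        using Bochner_Integration.integrable_add[OF A'(1) B'(1)] by (simp add: algebra_simps)
    qed
    also have "(\<integral>x. g (norm x) * of_real (x $ j / norm x) * (f x * \<phi> x)
        + \<Gamma> (norm x) * (f x * partial j \<phi> x + f' x * \<phi> x) \<partial>lborel) = (\<integral>x. ?A x + ?B x \<partial>lborel)"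
      by (rule Bochner_Integration.integral_cong) (auto simp: algebra_simps)
    also have "\<dots> = (\<integral>x. ?A x \<partial>lborel) + (\<integral>x. ?B x \<partial>lborel)"
      by (rule Bochner_Integration.integral_add[OF A'(1) B'(1)])
    finally have "(\<integral>x. ?A x \<partial>lborel) = - (\<integral>x. ?B x \<partial>lborel)" by (simp add: eq_neg_iff_add_eq_0)
    then show "(LINT x|lebesgue_on (ball 0 1). ?u x * partials [j] \<phi> x)
        = (- 1) ^ length [j] * (LINT x|lebesgue_on (ball 0 1). ?v x * \<phi> x)"
      using A'(2) B'(2) by (simp add: partials_def)
  qed
qed


section \<open>Homogeneous polynomials\<close>

text \<open>Generated by constants and coordinates, polynomial functions are closed under \<open>partial\<close> by the sum
  and product rules, which gives derivatives of all orders without any bookkeeping of exponents.\<close>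

inductive poly_fun :: "(real^'n::finite \<Rightarrow> complex) \<Rightarrow> bool" where
  const: "poly_fun (\<lambda>_. c)"
| coord: "poly_fun (\<lambda>x. of_real (x $ i))"
| add: "poly_fun f \<Longrightarrow> poly_fun g \<Longrightarrow> poly_fun (\<lambda>x. f x + g x)"
| mult: "poly_fun f \<Longrightarrow> poly_fun g \<Longrightarrow> poly_fun (\<lambda>x. f x * g x)"

lemma poly_fun_sum: "(\<And>a. a \<in> A \<Longrightarrow> poly_fun (f a)) \<Longrightarrow> poly_fun (\<lambda>x. \<Sum>a\<in>A. f a x)"
  by (induction A rule: infinite_finite_induct) (auto intro: poly_fun.intros)

lemma poly_fun_prod: "(\<And>a. a \<in> A \<Longrightarrow> poly_fun (f a)) \<Longrightarrow> poly_fun (\<lambda>x. \<Prod>a\<in>A. f a x)"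
  by (induction A rule: infinite_finite_induct) (auto intro: poly_fun.intros)

lemma poly_fun_power: "poly_fun f \<Longrightarrow> poly_fun (\<lambda>x. f x ^ k)"
  by (induction k) (auto intro: poly_fun.intros)

lemma homogeneous_polynomial_poly_fun: "homogeneous_polynomial m P \<Longrightarrow> poly_fun P"
proof -
  assume "homogeneous_polynomial m P"
  then obtain c where "P = (\<lambda>x. \<Sum>a | (\<Sum>i\<in>UNIV. a i) = m. c a * (\<Prod>i\<in>UNIV. of_real (x $ i) ^ a i))"
    by (auto simp: homogeneous_polynomial_def fun_eq_iff)
  then show ?thesis
    by (auto intro!: poly_fun_sum poly_fun_prod poly_fun_power poly_fun.intros)
qed

lemma partial_eqI: "(f has_derivative f') (at x) \<Longrightarrow> partial j f x = f' (axis j 1)"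
  unfolding partial_def by (metis frechet_derivative_at)

lemma poly_fun_differentiable_partial:
  assumes "poly_fun f"
  shows "(\<forall>x. f differentiable (at x)) \<and> (\<forall>j. poly_fun (partial j f))"
  using assms
proof induction
  case (const c)
  have "partial j (\<lambda>_. c) = (\<lambda>_. 0)" for j :: 'a
    by (rule ext, rule partial_eqI) simp
  then show ?case by (auto intro: poly_fun.const)
next
  case (coord i)
  have D: "((\<lambda>x::real^'a. complex_of_real (x $ i)) has_derivative (\<lambda>h. of_real (h $ i))) (at x)" for x
    by (intro has_derivative_of_real bounded_linear.has_derivative[OF bounded_linear_vec_nth] has_derivative_ident)
  have "partial j (\<lambda>x. of_real (x $ i)) = (\<lambda>_. of_real (axis j 1 $ i))" for j
    by (rule ext, rule partial_eqI[OF D])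
  then show ?case using D by (auto intro: poly_fun.const simp: differentiable_def)
next
  case (add f g)
  have D: "((\<lambda>x. f x + g x) has_derivative
      (\<lambda>h. frechet_derivative f (at x) h + frechet_derivative g (at x) h)) (at x)" for x
    using add by (intro has_derivative_add) (simp_all add: frechet_derivative_works[symmetric])
  have "partial j (\<lambda>x. f x + g x) = (\<lambda>x. partial j f x + partial j g x)" for j
    by (rule ext, subst partial_eqI[OF D]) (simp add: partial_def)
  then show ?case using D add by (auto intro: poly_fun.add simp: differentiable_def)
next
  case (mult f g)
  have D: "((\<lambda>x. f x * g x) has_derivative
      (\<lambda>h. f x * frechet_derivative g (at x) h + frechet_derivative f (at x) h * g x)) (at x)" for x
    using mult by (intro has_derivative_mult) (simp_all add: frechet_derivative_works[symmetric])
  have "partial j (\<lambda>x. f x * g x) = (\<lambda>x. f x * partial j g x + partial j f x * g x)" for j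
    by (rule ext, subst partial_eqI[OF D]) (simp add: partial_def)
  then show ?case using D mult by (auto intro!: poly_fun.add poly_fun.mult simp: differentiable_def)
qed

lemma poly_fun_partial: "poly_fun f \<Longrightarrow> poly_fun (partial j f)"
  using poly_fun_differentiable_partial by blast

lemma poly_fun_has_partial: "poly_fun f \<Longrightarrow> has_partial f (partial j f x) j x"
  using poly_fun_differentiable_partial has_partial_partial by blast

lemma poly_fun_continuous: "poly_fun f \<Longrightarrow> continuous_on S f"
  using poly_fun_differentiable_partial[of f]
  by (intro continuous_at_imp_continuous_on ballI differentiable_imp_continuous_within) simp

lemma homogeneous_polynomial_scale:
  assumes "homogeneous_polynomial m P"
  shows "P (t *\<^sub>R x) = of_real (t ^ m) * P x"
proof -
  obtain c where c: "\<And>x. P x = (\<Sum>a | (\<Sum>i\<in>UNIV. a i) = m. c a * (\<Prod>i\<in>UNIV. of_real (x $ i) ^ a i))"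
    using assms by (auto simp: homogeneous_polynomial_def)
  have "(\<Prod>i\<in>UNIV. complex_of_real ((t *\<^sub>R x) $ i) ^ a i)
      = of_real (t ^ m) * (\<Prod>i\<in>UNIV. of_real (x $ i) ^ a i)" if "(\<Sum>i\<in>UNIV. a i) = m" for a
    using that by (simp add: power_mult_distrib prod.distrib flip: power_sum)
  then show ?thesis unfolding c sum_distrib_left
    by (intro sum.cong) (simp_all add: mult.left_commute)
qed

text \<open>Differentiate \<open>P(t x) = t^m P(x)\<close> at \<open>t = 1\<close>.\<close>

lemma Euler_homogeneous:
  assumes P: "homogeneous_polynomial m P"
  shows "(\<Sum>i\<in>UNIV. of_real (x $ i) * partial i P x) = of_nat m * P x"
proof -
  have "P differentiable (at x)"
    using poly_fun_differentiable_partial homogeneous_polynomial_poly_fun[OF P] by blast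
  then have D: "(P has_derivative frechet_derivative P (at x)) (at x)" (is "(_ has_derivative ?P') _")
    by (simp add: frechet_derivative_works[symmetric])
  then have lin: "linear ?P'" by (rule has_derivative_linear)
  have "((\<lambda>t. t *\<^sub>R x) has_derivative (\<lambda>s. s *\<^sub>R x)) (at 1)"
    by (auto intro!: derivative_eq_intros)
  moreover have "(P has_derivative ?P') (at (1 *\<^sub>R x))" using D by simp
  ultimately have "((\<lambda>t. P (t *\<^sub>R x)) has_derivative (\<lambda>s. ?P' (s *\<^sub>R x))) (at 1)"
    by (rule has_derivative_compose)
  then have "((\<lambda>t. P (t *\<^sub>R x)) has_vector_derivative ?P' x) (at 1)"
    by (simp add: has_vector_derivative_def linear_cmul[OF lin])
  moreover have "((\<lambda>t. P (t *\<^sub>R x)) has_vector_derivative of_nat m * P x) (at 1)"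
  proof -
    have "((\<lambda>t::real. t ^ m) has_vector_derivative real m) (at 1)"
      by (auto intro!: derivative_eq_intros simp: has_real_derivative_iff_has_vector_derivative[symmetric])
    from bounded_linear.has_vector_derivative[OF bounded_linear_of_real this]
    have "((\<lambda>t. complex_of_real (t ^ m) * P x) has_vector_derivative of_real (real m) * P x) (at 1)"
      by (rule has_vector_derivative_mult_left)
    then show ?thesis by (simp add: homogeneous_polynomial_scale[OF P])
  qed
  ultimately have "?P' x = of_nat m * P x" by (rule vector_derivative_unique_at)
  moreover have "?P' x = (\<Sum>i\<in>UNIV. of_real (x $ i) * partial i P x)"
  proof -
    have "?P' x = ?P' (\<Sum>i\<in>UNIV. (x $ i) *\<^sub>R axis i 1)"
      by (simp add: basis_expansion flip: scalar_mult_eq_scaleR)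
    also have "\<dots> = (\<Sum>i\<in>UNIV. (x $ i) *\<^sub>R ?P' (axis i 1))"
      by (simp add: linear_sum[OF lin] linear_cmul[OF lin])
    finally show ?thesis by (simp add: partial_def scaleR_conv_of_real)
  qed
  ultimately show ?thesis by simp
qed

lemma poly_fun_bounded_ball:
  assumes "finite F" "\<And>f. f \<in> F \<Longrightarrow> poly_fun f"
  obtains C where "C \<ge> 0" "\<And>f x. f \<in> F \<Longrightarrow> norm x < 1 \<Longrightarrow> norm (f x) \<le> C"
proof -
  have "\<exists>C\<ge>0. \<forall>f\<in>F. \<forall>x. norm x < 1 \<longrightarrow> norm (f x) \<le> C"
    using assms
  proof (induction F rule: finite_induct)
    case empty
    then show ?case by auto
  next
    case (insert f F)
    then obtain C where C: "C \<ge> 0" "\<And>f x. f \<in> F \<Longrightarrow> norm x < 1 \<Longrightarrow> norm (f x) \<le> C" by auto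
    have "compact (f ` cball 0 1)"
      using insert.prems[of f] by (intro compact_continuous_image poly_fun_continuous) auto
    then obtain B where "\<And>y. y \<in> f ` cball 0 1 \<Longrightarrow> norm y \<le> B"
      using compact_imp_bounded bounded_iff by metis
    then have B: "norm (f x) \<le> B" if "norm x < 1" for x using that by auto
    show ?case
      using C B by (intro exI[of _ "max C B"]) (auto simp: le_max_iff_disj)
  qed
  then show thesis using that by blast
qed

lemma has_partial_coord: "has_partial (\<lambda>x. of_real (x $ i)) (if i = j then 1 else 0) j x"
proof -
  have "((\<lambda>t. complex_of_real (x $ i) + of_real t * (if i = j then 1 else 0)) has_vector_derivative
     of_real 1 * (if i = j then 1 else 0)) (at 0)"
    unfolding has_vector_derivative_def by (auto intro!: derivative_eq_intros simp: scaleR_conv_of_real)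
  then show ?thesis by (auto simp: has_partial_def axis_def)
qed

lemma has_partial_inverse_norm_power:
  assumes "x \<noteq> 0"
  shows "has_partial (\<lambda>x. of_real (inverse (norm x) ^ k))
    (of_real (- real k * x $ j * inverse (norm x) ^ (k + 2))) j x"
proof -
  have "((\<lambda>s. norm (x + s *\<^sub>R axis j 1)) has_real_derivative x $ j / norm x) (at 0)"
    using norm_line_derivative[of x 0 j] assms by simp
  then have "((\<lambda>s. inverse (norm (x + s *\<^sub>R axis j 1)) ^ k) has_real_derivative
      real k * (inverse (norm x) ^ (k - 1) * - (inverse (norm x) * (x $ j / norm x) * inverse (norm x)))) (at 0)"
    using assms by (auto intro!: derivative_eq_intros)
  moreover have "real k * (inverse (norm x) ^ (k - 1) * - (inverse (norm x) * (x $ j / norm x) * inverse (norm x)))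
      = - real k * x $ j * inverse (norm x) ^ (k + 2)"
    by (cases k) (simp_all add: divide_inverse algebra_simps)
  ultimately have "((\<lambda>s. inverse (norm (x + s *\<^sub>R axis j 1)) ^ k) has_vector_derivative
      - real k * x $ j * inverse (norm x) ^ (k + 2)) (at 0)"
    by (simp add: has_real_derivative_iff_has_vector_derivative)
  then show ?thesis
    unfolding has_partial_def by (rule bounded_linear.has_vector_derivative[OF bounded_linear_of_real])
qed

text \<open>Bounds of order \<open>1/r\<close> are absorbed into the single majorant used for second derivatives.\<close>

lemma inverse_le_one_plus_inverse_square: "1 / r \<le> 1 + 1 / (r :: real)\<^sup>2"
proof -
  have "0 \<le> (1 / r - 1 / 2)\<^sup>2" by simp
  then have "1 / r \<le> (1 / r)\<^sup>2 + 1 / 4" by (simp add: power2_diff power_divide)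
  then show ?thesis by (simp add: power_divide)
qed

section \<open>Derivatives of the separated solution\<close>

locale separated_solution = radial_potential V N
  for V :: "real \<Rightarrow> complex" and N :: nat +
  fixes P :: "real^'n::finite \<Rightarrow> complex" and m :: nat
  assumes dim: "CARD('n) \<ge> 3" and N_eq: "N + 2 = 2 * m + CARD('n)"
    and homogeneous: "homogeneous_polynomial m P" and harm: "harmonic P"
begin

text \<open>The largest singularity that occurs: \<open>1 / |x|\<^sup>2\<close> from the angular part of the second derivatives,
  \<open>V\<close> from their radial part.\<close>

definition majorant :: "real \<Rightarrow> real^'n \<Rightarrow> real" where
  "majorant C x = C * (1 + 1 / (norm x)\<^sup>2 + norm (V (norm x)))"

lemma majorant_integrable: "integrable lborel (\<lambda>x. indicator (ball 0 1) x * majorant C x)"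
  unfolding majorant_def
proof (rule integrable_radial_ball[OF dim, of "\<lambda>r. C * (1 + 1 / r\<^sup>2 + norm (V r))"])
  have "integrable lborel (\<lambda>r :: real. 2 * \<bar>C\<bar> * indicator {0<..<1} r + \<bar>C\<bar> * weight r)"
    using weight_integrable by simp
  then show "integrable lborel (\<lambda>r. indicator {0<..<1} r * (r\<^sup>2 * (C * (1 + 1 / r\<^sup>2 + norm (V r)))))"
  proof (rule Bochner_Integration.integrable_bound)
    have "norm (indicator {0<..<1} r * (r\<^sup>2 * (C * (1 + 1 / r\<^sup>2 + norm (V r)))))
        \<le> 2 * \<bar>C\<bar> * indicator {0<..<1} r + \<bar>C\<bar> * weight r" for r :: real
    proof (cases "r \<in> {0<..<1}")
      case True
      then have "r * (r * norm (V r)) \<le> 1 * weight r"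
        using weight_nonneg[of r] unfolding weight_def by (intro mult_right_mono) auto
      moreover have "r\<^sup>2 \<le> 1" using True by (simp add: power_le_one)
      ultimately have "r\<^sup>2 + 1 + r\<^sup>2 * norm (V r) \<le> 2 + weight r" by (simp add: power2_eq_square mult.assoc)
      then have "\<bar>C\<bar> * (r\<^sup>2 + 1 + r\<^sup>2 * norm (V r)) \<le> \<bar>C\<bar> * (2 + weight r)" by (rule mult_left_mono) simp
      moreover have "norm (indicator {0<..<1} r * (r\<^sup>2 * (C * (1 + 1 / r\<^sup>2 + norm (V r)))))
          = \<bar>C\<bar> * (r\<^sup>2 + 1 + r\<^sup>2 * norm (V r))"
      proof -
        have "r\<^sup>2 * (C * (1 + 1 / r\<^sup>2 + norm (V r))) = C * (r\<^sup>2 + 1 + r\<^sup>2 * norm (V r))"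
          using True by (simp add: field_simps)
        moreover have "\<bar>r\<^sup>2 + 1 + r\<^sup>2 * norm (V r)\<bar> = r\<^sup>2 + 1 + r\<^sup>2 * norm (V r)"
          by (intro abs_of_nonneg add_nonneg_nonneg) auto
        ultimately show ?thesis using True by (simp add: abs_mult)
      qed
      ultimately show ?thesis using True by (simp add: algebra_simps)
    qed (use weight_nonneg in auto)
    then show "AE r :: real in lborel. norm (indicator {0<..<1} r * (r\<^sup>2 * (C * (1 + 1 / r\<^sup>2 + norm (V r)))))
        \<le> norm (2 * \<bar>C\<bar> * indicator {0<..<1} r + \<bar>C\<bar> * weight r)"
    proof (intro AE_I2)
      fix r :: real
      have "2 * \<bar>C\<bar> * indicator {0<..<1} r + \<bar>C\<bar> * weight r \<le> norm (2 * \<bar>C\<bar> * indicator {0<..<1} r + \<bar>C\<bar> * weight r)"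
        unfolding real_norm_def by (rule abs_ge_self)
      with \<open>norm (indicator {0<..<1} r * (r\<^sup>2 * (C * (1 + 1 / r\<^sup>2 + norm (V r)))))
        \<le> 2 * \<bar>C\<bar> * indicator {0<..<1} r + \<bar>C\<bar> * weight r\<close>
      show "norm (indicator {0<..<1} r * (r\<^sup>2 * (C * (1 + 1 / r\<^sup>2 + norm (V r)))))
        \<le> norm (2 * \<bar>C\<bar> * indicator {0<..<1} r + \<bar>C\<bar> * weight r)"
        by (rule order_trans)
    qed
  qed measurable
qed measurable

lemma poly_P: "poly_fun P"
  by (rule homogeneous_polynomial_poly_fun[OF homogeneous])

lemma P_bounds:
  obtains C where "C \<ge> 0" "\<And>x. norm x < 1 \<Longrightarrow> norm (P x) \<le> C"
    "\<And>x i. norm x < 1 \<Longrightarrow> norm (partial i P x) \<le> C"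
    "\<And>x i j. norm x < 1 \<Longrightarrow> norm (partial j (partial i P) x) \<le> C"
proof -
  let ?F = "{P} \<union> range (\<lambda>i. partial i P) \<union> range (\<lambda>(i, j). partial j (partial i P))"
  obtain C where C: "C \<ge> 0" "\<And>f x. f \<in> ?F \<Longrightarrow> norm x < 1 \<Longrightarrow> norm (f x) \<le> C"
    by (rule poly_fun_bounded_ball[of ?F]) (auto intro: poly_P poly_fun_partial)
  show thesis
    using C(1) by (rule that) (rule C(2), auto)+
qed

text \<open>Since \<open>slope = flux / r^(N+1)\<close>, the product \<open>flux Q_i\<close> is the radial part \<open>slope (x_i / |x|) P\<close> of the
  gradient. This form separates it into the flux, an indefinite integral, and a function that is
  smooth off the origin. \<open>Q' i j\<close> is \<open>\<partial>_j Q_i\<close>.\<close>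

definition Q :: "'n \<Rightarrow> real^'n \<Rightarrow> complex" where
  "Q i x = P x * of_real (x $ i) * of_real (inverse (norm x) ^ (N + 2))"

definition Q' :: "'n \<Rightarrow> 'n \<Rightarrow> real^'n \<Rightarrow> complex" where
  "Q' i j x = P x * of_real (x $ i) * of_real (- real (N + 2) * x $ j * inverse (norm x) ^ (N + 2 + 2))
     + (P x * (if i = j then 1 else 0) + partial j P x * of_real (x $ i)) * of_real (inverse (norm x) ^ (N + 2))"

definition u :: "real^'n \<Rightarrow> complex" where "u x = regular (norm x) * P x"

definition grad :: "'n \<Rightarrow> real^'n \<Rightarrow> complex" where
  "grad i x = slope (norm x) * of_real (x $ i / norm x) * P x + regular (norm x) * partial i P x"

definition hess :: "'n \<Rightarrow> 'n \<Rightarrow> real^'n \<Rightarrow> complex" where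
  "hess i j x =
     (slope (norm x) * of_real (x $ j / norm x) * partial i P x + regular (norm x) * partial j (partial i P) x)
   + (flux_density (norm x) * of_real (x $ j / norm x) * Q i x + flux (norm x) * Q' i j x)"

lemma AE_ball_punctured:
  assumes "\<And>x :: real^'n. 0 < norm x \<Longrightarrow> norm x < 1 \<Longrightarrow> R x"
  shows "AE x in lebesgue. x \<in> ball 0 1 \<longrightarrow> R x"
  unfolding AE_completion_iff
  using AE_lborel_singleton[of "0 :: real^'n"] by eventually_elim (auto intro: assms)

text \<open>Outside the unit interval the radial factor is an artefact of the integral equation and need not be
  the indefinite integral of \<open>slope\<close>; the auxiliary \<open>\<Gamma>\<close> is that indefinite integral everywhere and
  agrees with the radial factor where it matters.\<close>

lemma regular_times_poly:
  assumes f: "poly_fun f" and C: "C \<ge> 0" "\<And>x. norm x < 1 \<Longrightarrow> norm (f x) \<le> C"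
      "\<And>x. norm x < 1 \<Longrightarrow> norm (partial j f x) \<le> C"
  shows "weak_deriv (ball 0 1) [j] (\<lambda>x :: real^'n. regular (norm x) * f x)
     (\<lambda>x. slope (norm x) * of_real (x $ j / norm x) * f x + regular (norm x) * partial j f x)"
    and "integrable (lebesgue_on (ball 0 1)) (\<lambda>x. regular (norm x) * f x)"
    and "integrable (lebesgue_on (ball 0 1)) 
      (\<lambda>x. slope (norm x) * of_real (x $ j / norm x) * f x + regular (norm x) * partial j f x)"
proof -
  define \<Gamma> where "\<Gamma> r = 1 + (\<integral>s. indicator {..r} s *\<^sub>R slope s \<partial>lborel)" for r
  have \<Gamma>_eq: "\<Gamma> r = regular r" if "0 < r" "r < 1" for r
    using regular_eq_integral_slope(2)[of r] that by (simp add: \<Gamma>_def)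
  let ?C = "exp mass * (1 + mass) * C"
  have maj: "K * C \<le> majorant ?C x" if "K \<le> exp mass * (1 + mass) * (1 + 1 / (norm x)\<^sup>2)" for x K
  proof -
    have "K * C \<le> exp mass * (1 + mass) * (1 + 1 / (norm x)\<^sup>2) * C"
      using that C(1) by (rule mult_right_mono)
    also have "\<dots> \<le> majorant ?C x"
      unfolding majorant_def using C(1) mass_nonneg
      by (simp add: distrib_left mult.commute mult.left_commute)
    finally show ?thesis .
  qed
  have E: "exp mass * a \<le> exp mass * (1 + mass) * (1 + 1 / (norm x)\<^sup>2)"
    if "a \<le> (1 + mass) * (1 + 1 / (norm x)\<^sup>2)" for a and x :: "real^'n"
    using that by (simp add: mult.assoc)
  have E1: "exp mass \<le> exp mass * (1 + mass) * (1 + 1 / (norm x)\<^sup>2)" for x :: "real^'n"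
    using E[of 1 x] mass_nonneg mult_mono[of 1 "1 + mass" 1 "1 + 1 / (norm x)\<^sup>2"] by simp
  have E2: "exp mass * mass / norm x \<le> exp mass * (1 + mass) * (1 + 1 / (norm x)\<^sup>2)" for x :: "real^'n"
  proof -
    have "1 / norm x \<le> 1 + 1 / (norm x)\<^sup>2"
      by (rule inverse_le_one_plus_inverse_square)
    then have "mass * (1 / norm x) \<le> (1 + mass) * (1 + 1 / (norm x)\<^sup>2)"
      using mass_nonneg by (intro mult_mono) auto
    from E[OF this] show ?thesis by simp
  qed
  have \<Gamma>_diff: "\<Gamma> s = \<Gamma> r + (\<integral>u. indicator {r..s} u *\<^sub>R slope u \<partial>lborel)" if "r \<le> s" for r s
    unfolding \<Gamma>_def indefinite_integral_split[OF slope_integrable that] by (rule add.assoc[symmetric])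
  have \<Gamma>_borel: "\<Gamma> \<in> borel_measurable borel"
    unfolding \<Gamma>_def[abs_def] by (intro borel_measurable_add indefinite_integral_measurable) simp_all
  have reg: "norm (\<Gamma> r) \<le> exp mass" if "0 < r" "r < 1" for r
    unfolding \<Gamma>_eq[OF that] by (rule norm_regular_le)
  have b1: "norm (\<Gamma> (norm x) * f x) \<le> majorant ?C x" if x: "0 < norm x" "norm x < 1" for x
  proof -
    have "norm (\<Gamma> (norm x) * f x) \<le> exp mass * C"
      unfolding norm_mult using x by (intro mult_mono reg C) auto
    then show ?thesis using maj[OF E1] by (rule order_trans)
  qed
  have b3: "norm (\<Gamma> (norm x) * partial j f x) \<le> majorant ?C x" if x: "0 < norm x" "norm x < 1" for x
  proof -
    have "norm (\<Gamma> (norm x) * partial j f x) \<le> exp mass * C"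
      unfolding norm_mult using x by (intro mult_mono reg C) auto
    then show ?thesis using maj[OF E1] by (rule order_trans)
  qed
  have b2: "norm (slope (norm x) * f x) \<le> majorant ?C x" if x: "0 < norm x" "norm x < 1" for x
  proof -
    have "norm (slope (norm x) * f x) \<le> exp mass * mass / norm x * C"
      unfolding norm_mult using x mass_nonneg by (intro mult_mono norm_slope_le C) auto
    then show ?thesis using maj[OF E2] by (rule order_trans)
  qed
  have dim2: "CARD('n) \<ge> 2" using dim by simp
  note main = weak_deriv_radial_times[OF dim2 slope_integrable \<Gamma>_diff \<Gamma>_borel poly_fun_has_partial[OF f]
      poly_fun_continuous[OF f] poly_fun_continuous[OF poly_fun_partial[OF f]] majorant_integrable b1 b2 b3]
  have eq: "AE x in lebesgue. x \<in> ball (0 :: real^'n) 1 \<longrightarrow> \<Gamma> (norm x) * f x = regular (norm x) * f x"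
    "AE x in lebesgue. x \<in> ball (0 :: real^'n) 1 \<longrightarrow>
       slope (norm x) * of_real (x $ j / norm x) * f x + \<Gamma> (norm x) * partial j f x
     = slope (norm x) * of_real (x $ j / norm x) * f x + regular (norm x) * partial j f x"
    by (rule AE_ball_punctured, simp add: \<Gamma>_eq)+
  show "weak_deriv (ball 0 1) [j] (\<lambda>x :: real^'n. regular (norm x) * f x)
     (\<lambda>x. slope (norm x) * of_real (x $ j / norm x) * f x + regular (norm x) * partial j f x)"
    by (rule weak_deriv_spike[OF main(1) _ eq]) simp_all
  have spike: "integrable (lebesgue_on (ball 0 1)) h'"
    if "integrable (lebesgue_on (ball 0 1)) h" "AE x in lebesgue. x \<in> ball 0 1 \<longrightarrow> h x = h' x"
    for h h' :: "real^'n \<Rightarrow> complex"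
  proof -
    have "integrable lebesgue (\<lambda>x. indicator (ball 0 1) x *\<^sub>R h x)"
      using that(1) by (simp add: integral_lebesgue_on)
    then have "integrable lebesgue (\<lambda>x. indicator (ball 0 1) x *\<^sub>R h' x)"
      by (rule integrable_lebesgue_spike[rotated])
        (use that(2) in eventually_elim, auto simp: indicator_def)
    then show ?thesis by (simp add: integral_lebesgue_on)
  qed
  show "integrable (lebesgue_on (ball 0 1)) (\<lambda>x. regular (norm x) * f x)"
    by (rule spike[OF main(2) eq(1)])
  show "integrable (lebesgue_on (ball 0 1)) 
      (\<lambda>x. slope (norm x) * of_real (x $ j / norm x) * f x + regular (norm x) * partial j f x)"
    by (rule spike[OF main(3) eq(2)])
qed

lemma continuous_Q: "continuous_on (- {0}) (Q i)"
  unfolding Q_def[abs_def] by (intro continuous_intros poly_fun_continuous poly_P) auto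

lemma continuous_Q': "continuous_on (- {0}) (Q' i j)"
  unfolding Q'_def[abs_def] by (intro continuous_intros poly_fun_continuous poly_fun_partial poly_P) auto

lemma has_partial_Q: "x \<noteq> 0 \<Longrightarrow> has_partial (Q i) (Q' i j x) j x"
  unfolding Q_def[abs_def] Q'_def
  by (intro has_partial_mult has_partial_coord has_partial_inverse_norm_power poly_fun_has_partial poly_P)

text \<open>The flux is \<open>O(r^N)\<close>, its density \<open>O(r^(N+1) |V|)\<close>, while \<open>Q_i\<close> is \<open>O(r^(-N-1))\<close> and its derivative
  \<open>O(r^(-N-2))\<close>: the products stay below the majorant.\<close>

lemma flux_times_Q:
  "weak_deriv (ball 0 1) [j] (\<lambda>x. flux (norm x) * Q i x)
     (\<lambda>x. flux_density (norm x) * of_real (x $ j / norm x) * Q i x + flux (norm x) * Q' i j x)"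
    "integrable (lebesgue_on (ball 0 1)) 
      (\<lambda>x. flux_density (norm x) * of_real (x $ j / norm x) * Q i x + flux (norm x) * Q' i j x)"
proof -
  obtain C where C: "C \<ge> 0" "\<And>x. norm x < 1 \<Longrightarrow> norm (P x) \<le> C"
    "\<And>x i. norm x < 1 \<Longrightarrow> norm (partial i P x) \<le> C" by (rule P_bounds) blast
  let ?C = "exp mass * (1 + mass) * (C * real (N + 4))"
  have b: "norm (flux (norm x) * Q i x) \<le> majorant ?C x" "norm (flux_density (norm x) * Q i x) \<le> majorant ?C x"
    "norm (flux (norm x) * Q' i j x) \<le> majorant ?C x" if x: "0 < norm x" "norm x < 1" for x
  proof -
    define r where "r = norm x"
    have r: "0 < r" "r < 1" using x by (auto simp: r_def)
    have comp: "\<bar>x $ k\<bar> \<le> r" for k unfolding r_def by (rule component_le_norm_cart)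
    have Qb: "norm (Q i x) \<le> C / r ^ (N + 1)"
    proof -
      have "norm (Q i x) = norm (P x) * \<bar>x $ i\<bar> * inverse r ^ (N + 2)"
        using r unfolding Q_def norm_mult norm_of_real r_def[symmetric] by (simp add: abs_of_pos)
      also have "\<dots> \<le> C * r * inverse r ^ (N + 2)"
        using C x comp r by (intro mult_right_mono mult_mono) auto
      also have "\<dots> = C / r ^ (N + 1)" using r by (simp add: field_simps)
      finally show ?thesis .
    qed
    have Q'b: "norm (Q' i j x) \<le> C * real (N + 4) / r ^ (N + 2)"
    proof -
      have "norm (Q' i j x) \<le> norm (P x * of_real (x $ i) * of_real (- real (N + 2) * x $ j * inverse r ^ (N + 2 + 2)))
         + norm ((P x * (if i = j then 1 else 0) + partial j P x * of_real (x $ i)) * of_real (inverse r ^ (N + 2)))"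
        unfolding Q'_def r_def[symmetric] by (rule norm_triangle_ineq)
      also have "norm (P x * of_real (x $ i) * of_real (- real (N + 2) * x $ j * inverse r ^ (N + 2 + 2)))
          \<le> C * r * (real (N + 2) * r * inverse r ^ (N + 2 + 2))"
        unfolding norm_mult norm_of_real abs_mult using C x comp r
        by (intro mult_mono) (auto simp: abs_mult power_abs)
      also have "norm ((P x * (if i = j then 1 else 0) + partial j P x * of_real (x $ i)) * of_real (inverse r ^ (N + 2)))
          \<le> (C * 1 + C * 1) * inverse r ^ (N + 2)"
      proof -
        have "norm (P x * (if i = j then 1 else 0) + partial j P x * of_real (x $ i)) \<le> C * 1 + C * 1"
          using C x comp[of i] r
          by (intro order_trans[OF norm_triangle_ineq] add_mono) (auto simp: norm_mult intro!: mult_mono mult_left_le order_trans[OF mult_mono[of _ C _ 1]])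
        then show ?thesis
          unfolding norm_mult[of _ "of_real (inverse r ^ (N + 2))"] norm_of_real
          using r by (simp only: abs_of_pos zero_less_power positive_imp_inverse_positive) (rule mult_right_mono; simp)
      qed
      also have "C * r * (real (N + 2) * r * inverse r ^ (N + 2 + 2)) = C * real (N + 2) * inverse r ^ (N + 2)"
        using r by (simp add: field_simps)
      finally show ?thesis by (simp add: divide_inverse power_inverse algebra_simps)
    qed
    have flux: "norm (flux r) \<le> exp mass * mass * r ^ N" using norm_flux_le[of r] r by simp
    have sq: "1 / r \<le> 1 + 1 / r\<^sup>2" 
      by (rule inverse_le_one_plus_inverse_square)
    have maj: "exp mass * mass * C * real (N + 4) * a \<le> majorant ?C x" if "a \<le> 1 + 1 / r\<^sup>2" "0 \<le> a" for a
    proof -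
      have "exp mass * mass * C * real (N + 4) * a \<le> ?C * (1 + 1 / r\<^sup>2 + norm (V r))"
        unfolding mult.assoc using that C(1) mass_nonneg r
        by (intro mult_left_mono mult_mono) (auto intro!: order_trans[OF that(1)] mult_nonneg_nonneg)
      then show ?thesis by (simp add: majorant_def r_def)
    qed
    have one: "C * 1 \<le> C * real (N + 4)" using C(1) by (intro mult_left_mono) auto
    show "norm (flux (norm x) * Q i x) \<le> majorant ?C x"
    proof -
      have "norm (flux r * Q i x) \<le> exp mass * mass * r ^ N * (C * real (N + 4) / r ^ (N + 1))"
        unfolding norm_mult using r mass_nonneg one
        by (intro mult_mono flux order_trans[OF Qb] divide_right_mono) auto
      also have "\<dots> = exp mass * mass * C * real (N + 4) * (1 / r)" using r by (simp add: field_simps)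
      also have "\<dots> \<le> majorant ?C x" using sq r by (intro maj) auto
      finally show ?thesis by (simp add: r_def)
    qed
    show "norm (flux (norm x) * Q' i j x) \<le> majorant ?C x"
    proof -
      have "norm (flux r * Q' i j x) \<le> exp mass * mass * r ^ N * (C * real (N + 4) / r ^ (N + 2))"
        unfolding norm_mult using r mass_nonneg by (intro mult_mono flux Q'b) auto
      also have "\<dots> = exp mass * mass * C * real (N + 4) * (1 / r\<^sup>2)" using r by (simp add: field_simps power2_eq_square)
      also have "\<dots> \<le> majorant ?C x" using r by (intro maj) auto
      finally show ?thesis by (simp add: r_def)
    qed
    show "norm (flux_density (norm x) * Q i x) \<le> majorant ?C x"
    proof -
      have "norm (flux_density r * Q i x) \<le> exp mass * r ^ N * weight r * (C * real (N + 4) / r ^ (N + 1))"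
        unfolding norm_mult using r one weight_nonneg
        by (intro mult_mono norm_flux_density_le order_trans[OF Qb] divide_right_mono) auto
      also have "\<dots> = exp mass * 1 * (C * real (N + 4)) * norm (V r)" using r by (simp add: weight_def field_simps)
      also have "\<dots> \<le> exp mass * (1 + mass) * (C * real (N + 4)) * (1 + 1 / r\<^sup>2 + norm (V r))"
        using mass_nonneg C(1) r by (intro mult_mono mult_left_mono) auto
      finally show ?thesis by (simp add: r_def majorant_def)
    qed
  qed
  have dim2: "CARD('n) \<ge> 2" using dim by simp
  note main = weak_deriv_radial_times[OF dim2 flux_density_integrable flux_diff flux_measurable has_partial_Q
      continuous_Q continuous_Q' majorant_integrable b]
  show "weak_deriv (ball 0 1) [j] (\<lambda>x. flux (norm x) * Q i x)
     (\<lambda>x. flux_density (norm x) * of_real (x $ j / norm x) * Q i x + flux (norm x) * Q' i j x)"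
    by (rule main(1))
  show "integrable (lebesgue_on (ball 0 1)) 
      (\<lambda>x. flux_density (norm x) * of_real (x $ j / norm x) * Q i x + flux (norm x) * Q' i j x)"
    by (rule main(3))
qed

end


section \<open>Lebesgue and Sobolev spaces\<close>

lemma Lp_space_1: "integrable (lebesgue_on \<Omega>) f \<Longrightarrow> f \<in> Lp_space 1 \<Omega>"
  by (auto simp: Lp_space_def)

lemma Lp_space_2:
  "f \<in> borel_measurable (lebesgue_on \<Omega>) \<Longrightarrow> integrable (lebesgue_on \<Omega>) (\<lambda>x. (norm (f x))\<^sup>2) \<Longrightarrow> f \<in> Lp_space 2 \<Omega>"
  by (simp add: Lp_space_def)

lemma Lp_space_spike:
  fixes f g :: "real^'n::finite \<Rightarrow> complex"
  assumes f: "f \<in> Lp_space q \<Omega>" and eq: "AE x in lebesgue. x \<in> \<Omega> \<longrightarrow> f x = g x" and \<Omega>: "\<Omega> \<in> sets lebesgue"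
  shows "g \<in> Lp_space q \<Omega>"
proof -
  have \<Omega>': "\<Omega> \<inter> space lebesgue \<in> sets lebesgue" using \<Omega> by simp
  have "(\<lambda>x. indicator \<Omega> x *\<^sub>R f x) \<in> borel_measurable lebesgue"
    using f by (simp add: Lp_space_def borel_measurable_restrict_space_iff[OF \<Omega>'])
  then have "(\<lambda>x. indicator \<Omega> x *\<^sub>R g x) \<in> borel_measurable lebesgue"
    by (rule borel_measurable_AE) (use eq in eventually_elim, auto simp: indicator_def)
  moreover have "integrable lebesgue (\<lambda>x. indicator \<Omega> x *\<^sub>R norm (f x) powr q)"
    using f \<Omega> by (simp add: Lp_space_def integral_lebesgue_on)
  then have "integrable lebesgue (\<lambda>x. indicator \<Omega> x *\<^sub>R norm (g x) powr q)"
    by (rule integrable_lebesgue_spike[rotated]) (use eq in eventually_elim, auto simp: indicator_def)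
  ultimately show ?thesis
    using \<Omega> by (simp add: Lp_space_def integral_lebesgue_on borel_measurable_restrict_space_iff[OF \<Omega>'])
qed

lemma SobolevI1:
  assumes "u \<in> Lp_space q \<Omega>" "locally_integrable \<Omega> u"
    and "\<And>i. weak_deriv \<Omega> [i] u (v i)" "\<And>i. v i \<in> Lp_space q \<Omega>"
  shows "u \<in> Sobolev 1 q \<Omega>"
proof -
  have "\<exists>g\<in>Lp_space q \<Omega>. weak_deriv \<Omega> js u g" if "length js \<le> 1" for js
  proof -
    consider "js = []" | i where "js = [i]"
      using \<open>length js \<le> 1\<close> by (cases js) auto
    then show ?thesis using assms weak_deriv_Nil by cases blast+
  qed
  then show ?thesis using assms(1) by (simp add: Sobolev_def)
qed

lemma SobolevI2:
  assumes "u \<in> Lp_space q \<Omega>" "locally_integrable \<Omega> u"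
    and "\<And>i. weak_deriv \<Omega> [i] u (v i)" "\<And>i. v i \<in> Lp_space q \<Omega>"
    and "\<And>i j. weak_deriv \<Omega> [i, j] u (h i j)" "\<And>i j. h i j \<in> Lp_space q \<Omega>"
  shows "u \<in> Sobolev 2 q \<Omega>"
proof -
  have "\<exists>g\<in>Lp_space q \<Omega>. weak_deriv \<Omega> js u g" if js: "length js \<le> 2" for js
  proof -
    consider "js = []" | i where "js = [i]" | i j where "js = [i, j]"
      using js by (cases js; cases "tl js"; cases "tl (tl js)") auto
    then show ?thesis using assms weak_deriv_Nil by cases blast+
  qed
  then show ?thesis using assms(1) by (simp add: Sobolev_def)
qed

context separated_solution
begin

lemma slope_flux: "0 < r \<Longrightarrow> r < 1 \<Longrightarrow> slope r = flux r * of_real (inverse r ^ Suc N)"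
  by (simp add: slope_def divide_inverse power_inverse)

lemma grad_eq:
  assumes "0 < norm x" "norm x < 1"
  shows "grad i x = regular (norm x) * partial i P x + flux (norm x) * Q i x"
  unfolding grad_def Q_def slope_flux[OF assms] by (simp add: divide_inverse)

lemma weak_deriv_u: "weak_deriv (ball 0 1) [i] u (grad i)"
  and u_integrable: "integrable (lebesgue_on (ball 0 1)) u"
  and grad_integrable: "integrable (lebesgue_on (ball 0 1)) (grad i)"
proof -
  obtain C where C: "C \<ge> 0" "\<And>x. norm x < 1 \<Longrightarrow> norm (P x) \<le> C"
    "\<And>x i. norm x < 1 \<Longrightarrow> norm (partial i P x) \<le> C" by (rule P_bounds) blast
  note main = regular_times_poly[OF poly_P C]
  show "weak_deriv (ball 0 1) [i] u (grad i)" "integrable (lebesgue_on (ball 0 1)) u"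
    "integrable (lebesgue_on (ball 0 1)) (grad i)"
    using main unfolding u_def[abs_def] grad_def[abs_def] by auto
qed

lemma weak_deriv_grad: "weak_deriv (ball 0 1) [j] (grad i) (hess i j)"
  and hess_integrable: "integrable (lebesgue_on (ball 0 1)) (hess i j)"
proof -
  obtain C where C: "C \<ge> 0" "\<And>x. norm x < 1 \<Longrightarrow> norm (P x) \<le> C"
    "\<And>x i. norm x < 1 \<Longrightarrow> norm (partial i P x) \<le> C"
    "\<And>x i j. norm x < 1 \<Longrightarrow> norm (partial j (partial i P) x) \<le> C" by (rule P_bounds) blast
  note main = regular_times_poly[OF poly_fun_partial[OF poly_P, of i] C(1) C(3) C(4)]
  have "weak_deriv (ball 0 1) [j] (\<lambda>x. regular (norm x) * partial i P x + flux (norm x) * Q i x) (hess i j)"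
    unfolding hess_def[abs_def]
    by (rule weak_deriv_add[OF main(1) flux_times_Q(1)]) (auto intro: fmeasurableD[OF lmeasurable_ball])
  then show "weak_deriv (ball 0 1) [j] (grad i) (hess i j)"
  proof (rule weak_deriv_spike)
    show "AE x in lebesgue. x \<in> ball 0 1 \<longrightarrow>
        regular (norm x) * partial i P x + flux (norm x) * Q i x = grad i x"
      by (rule AE_ball_punctured) (simp add: grad_eq)
  qed auto
  show "integrable (lebesgue_on (ball 0 1)) (hess i j)"
    unfolding hess_def[abs_def] by (rule Bochner_Integration.integrable_add[OF main(3) flux_times_Q(2)])
qed

text \<open>Multiply out with Euler's identity and \<open>\<Sum> x_i\<^sup>2 = r\<^sup>2\<close>. The term with the flux density gives \<open>V u\<close>, the
  Laplacian of \<open>P\<close> vanishes, and the remaining coefficient of \<open>flux r^(-N-2) P\<close> is \<open>m\<close> from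
  \<open>\<nabla>P\<close> plus \<open>m + n - (N + 2) = - m\<close> from the divergence of \<open>Q\<close>.\<close>

lemma trace_hess:
  assumes x: "0 < norm x" "norm x < 1"
  shows "(\<Sum>i\<in>UNIV. hess i i x) = V (norm x) * u x"
proof -
  define r where "r = norm x"
  define s :: complex where "s = of_real (inverse r)"
  have r: "0 < r" "r < 1" using x by (auto simp: r_def)
  have Euler: "(\<Sum>i\<in>UNIV. of_real (x $ i) * partial i P x) = of_nat m * P x"
    by (rule Euler_homogeneous[OF homogeneous])
  have Lap: "(\<Sum>i\<in>UNIV. partial i (partial i P) x) = 0"
    using harm by (simp add: harmonic_def partials_def)
  have sq: "(\<Sum>i\<in>UNIV. of_real (x $ i) * of_real (x $ i)) = (of_real (r\<^sup>2) :: complex)"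
  proof -
    have "r\<^sup>2 = (\<Sum>i\<in>UNIV. x $ i * x $ i)"
      unfolding r_def power2_norm_eq_inner by (simp add: inner_vec_def)
    then show ?thesis by simp
  qed
  have rs: "of_real (r\<^sup>2) * s ^ (k + 2) = s ^ k" for k
  proof -
    have "r\<^sup>2 * inverse r ^ (k + 2) = (r * inverse r)\<^sup>2 * inverse r ^ k"
      by (simp add: power_add power_mult_distrib power2_eq_square)
    then have "r\<^sup>2 * inverse r ^ (k + 2) = inverse r ^ k" using r by simp
    then show ?thesis unfolding s_def by (metis of_real_mult of_real_power)
  qed
  have sum1: "(\<Sum>i\<in>UNIV. slope r * of_real (x $ i / r) * partial i P x) = slope r * s * (of_nat m * P x)"
    unfolding Euler[symmetric] sum_distrib_left s_def by (simp add: divide_inverse ac_simps)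
  have sum3: "(\<Sum>i\<in>UNIV. flux_density r * of_real (x $ i / r) * Q i x) = flux_density r * P x * s ^ (N + 1)"
  proof -
    have "(\<Sum>i\<in>UNIV. flux_density r * of_real (x $ i / r) * Q i x)
        = flux_density r * P x * s ^ (N + 1 + 2) * (\<Sum>i\<in>UNIV. of_real (x $ i) * of_real (x $ i))"
      unfolding sum_distrib_left Q_def s_def r_def[symmetric] by (simp add: divide_inverse ac_simps)
    also have "\<dots> = flux_density r * P x * s ^ (N + 1)"
      unfolding sq mult.assoc using rs[of "N + 1"] by (simp only: mult.commute[of "s ^ (N + 1 + 2)"])
    finally show ?thesis .
  qed
  have sum4: "(\<Sum>i\<in>UNIV. Q' i i x) = - (of_nat m * P x * s ^ (N + 2))"
  proof -
    have "(\<Sum>i\<in>UNIV. Q' i i x) = (\<Sum>i\<in>UNIV. - of_nat (N + 2) * P x * s ^ (N + 2 + 2) * (of_real (x $ i) * of_real (x $ i))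
        + s ^ (N + 2) * P x + s ^ (N + 2) * (of_real (x $ i) * partial i P x))"
      by (rule sum.cong[OF refl]) (simp add: Q'_def s_def r_def[symmetric] algebra_simps)
    also have "\<dots> = - of_nat (N + 2) * P x * s ^ (N + 2 + 2) * of_real (r\<^sup>2)
        + of_nat CARD('n) * (s ^ (N + 2) * P x) + s ^ (N + 2) * (of_nat m * P x)"
      unfolding sum.distrib sum_distrib_left[symmetric] sq Euler by simp
    also have "\<dots> = - of_nat (N + 2) * P x * s ^ (N + 2)
        + of_nat CARD('n) * (s ^ (N + 2) * P x) + s ^ (N + 2) * (of_nat m * P x)"
      unfolding mult.assoc using rs[of "N + 2"] by (simp only: mult.commute[of "s ^ (N + 2 + 2)"])
    also have "\<dots> = (- of_nat (N + 2) + of_nat CARD('n) + of_nat m) * (s ^ (N + 2) * P x)"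
      by (simp add: algebra_simps)
    also have "(- of_nat (N + 2) + of_nat CARD('n) + of_nat m :: complex) = - of_nat m"
      unfolding N_eq by simp
    finally show ?thesis by (simp add: ac_simps)
  qed
  have "(\<Sum>i\<in>UNIV. hess i i x) = slope r * s * (of_nat m * P x) + 0
      + (flux_density r * P x * s ^ (N + 1) + flux r * (- (of_nat m * P x * s ^ (N + 2))))"
    unfolding hess_def r_def[symmetric] sum.distrib sum1 sum3 sum_distrib_left[symmetric] sum4 Lap mult_zero_right ..
  also have "slope r * s = flux r * s ^ (N + 2)"
    unfolding slope_flux[OF r] s_def by simp
  also have "flux_density r * P x * s ^ (N + 1) = V r * u x"
  proof -
    have "r ^ Suc N * inverse r ^ Suc N = (r * inverse r) ^ Suc N" by (rule power_mult_distrib[symmetric])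
    then have "r ^ Suc N * inverse r ^ Suc N = 1" using r by simp
    then have "of_real (r ^ Suc N) * s ^ Suc N = 1" 
      unfolding s_def by (metis of_real_mult of_real_power of_real_1)
    then have "of_real (r ^ Suc N) * s ^ Suc N * (V r * regular r * P x) = V r * regular r * P x" by simp
    then show ?thesis by (simp add: flux_density_def u_def r_def[symmetric] ac_simps)
  qed
  finally show ?thesis by (simp add: r_def)
qed

lemma u_L2: "u \<in> Lp_space 2 (ball 0 1)" and grad_L2: "grad i \<in> Lp_space 2 (ball 0 1)"
proof -
  obtain C where C: "C \<ge> 0" "\<And>x. norm x < 1 \<Longrightarrow> norm (P x) \<le> C"
    "\<And>x i. norm x < 1 \<Longrightarrow> norm (partial i P x) \<le> C" by (rule P_bounds) blast
  let ?K = "exp mass * (1 + mass) * C"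
  have L2: "k \<in> Lp_space 2 (ball 0 1)" if int: "integrable (lebesgue_on (ball 0 1)) k"
      and [measurable]: "k \<in> borel_measurable borel"
      and b: "\<And>x. 0 < norm x \<Longrightarrow> norm x < 1 \<Longrightarrow> norm (k x) \<le> ?K * (1 + 1 / norm x)" for k :: "real^'n \<Rightarrow> complex"
  proof (rule Lp_space_2)
    show "k \<in> borel_measurable (lebesgue_on (ball 0 1))" using int by auto
    have [measurable]: "(ball 0 1 :: (real^'n) set) \<in> sets borel" by simp
    have "integrable lborel (\<lambda>x. indicator (ball 0 1) x *\<^sub>R (norm (k x))\<^sup>2)"
    proof (rule Bochner_Integration.integrable_bound[OF majorant_integrable[of "2 * ?K\<^sup>2"]])
      show "AE x in lborel. norm (indicator (ball 0 1) x *\<^sub>R (norm (k x))\<^sup>2)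
          \<le> norm (indicator (ball 0 1) x * majorant (2 * ?K\<^sup>2) x)"
        using AE_lborel_singleton[of "0 :: real^'n"]
      proof eventually_elim
        fix x :: "real^'n" assume "x \<noteq> 0"
        show "norm (indicator (ball 0 1) x *\<^sub>R (norm (k x))\<^sup>2)
          \<le> norm (indicator (ball 0 1) x * majorant (2 * ?K\<^sup>2) x)"
        proof (cases "x \<in> ball 0 1")
          case True
          have "(norm (k x))\<^sup>2 \<le> (?K * (1 + 1 / norm x))\<^sup>2"
            using b[of x] True \<open>x \<noteq> 0\<close> by (intro power_mono) auto
          also have "\<dots> = ?K\<^sup>2 * (1 + 1 / norm x)\<^sup>2" by (rule power_mult_distrib)
          also have "\<dots> \<le> ?K\<^sup>2 * (2 * (1 + 1 / (norm x)\<^sup>2))"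
          proof (rule mult_left_mono)
            have "0 \<le> (1 - 1 / norm x)\<^sup>2" by simp
            then show "(1 + 1 / norm x)\<^sup>2 \<le> 2 * (1 + 1 / (norm x)\<^sup>2)"
              by (simp add: power2_sum power2_diff power_divide)
          qed simp
          also have "\<dots> = 2 * ?K\<^sup>2 * (1 + 1 / (norm x)\<^sup>2)" by (simp only: mult.assoc mult.left_commute)
          also have "\<dots> \<le> majorant (2 * ?K\<^sup>2) x"
            unfolding majorant_def by (rule mult_left_mono) auto
          finally show ?thesis using True by simp
        qed simp
      qed
    qed measurable
    then show "integrable (lebesgue_on (ball 0 1)) (\<lambda>x. (norm (k x))\<^sup>2)"
      by (subst integral_lebesgue_on_borel(2)) simp_all
  qed
  have Pm [measurable]: "P \<in> borel_measurable borel" "partial i P \<in> borel_measurable borel" for i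
    by (intro borel_measurable_continuous_onI poly_fun_continuous poly_fun_partial poly_P)+
  have Kmono: "a * C \<le> ?K * (1 + 1 / norm x)"
    if "a \<le> exp mass * (1 + mass / norm x)" for a and x :: "real^'n"
  proof -
    have "1 + mass / norm x \<le> (1 + mass) * (1 + 1 / norm x)"
      using mass_nonneg by (simp add: algebra_simps add_divide_distrib)
    then have "exp mass * (1 + mass / norm x) \<le> exp mass * ((1 + mass) * (1 + 1 / norm x))" by simp
    with that have "a \<le> exp mass * ((1 + mass) * (1 + 1 / norm x))" by (rule order_trans)
    then have "a * C \<le> exp mass * ((1 + mass) * (1 + 1 / norm x)) * C" using C(1) by (rule mult_right_mono)
    then show ?thesis by (simp add: ac_simps)
  qed
  show "u \<in> Lp_space 2 (ball 0 1)"
  proof (rule L2[OF u_integrable])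
    show "u \<in> borel_measurable borel" unfolding u_def[abs_def] by measurable
    fix x :: "real^'n" assume x: "0 < norm x" "norm x < 1"
    have "norm (u x) \<le> exp mass * C"
      unfolding u_def norm_mult using x by (intro mult_mono norm_regular_le C) auto
    also have "\<dots> \<le> ?K * (1 + 1 / norm x)" by (rule Kmono) (use mass_nonneg in simp)
    finally show "norm (u x) \<le> ?K * (1 + 1 / norm x)" .
  qed
  show "grad i \<in> Lp_space 2 (ball 0 1)"
  proof (rule L2[OF grad_integrable])
    show "grad i \<in> borel_measurable borel" unfolding grad_def[abs_def] by measurable
    fix x :: "real^'n" assume x: "0 < norm x" "norm x < 1"
    have c: "norm (of_real (x $ i / norm x) :: complex) \<le> 1"
      using component_le_norm_cart[of x i] x by (simp add: norm_divide divide_le_eq)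
    have "norm (grad i x) \<le> norm (slope (norm x) * of_real (x $ i / norm x) * P x)
        + norm (regular (norm x) * partial i P x)" unfolding grad_def by (rule norm_triangle_ineq)
    also have "\<dots> \<le> exp mass * mass / norm x * 1 * C + exp mass * C"
      unfolding norm_mult using x c mass_nonneg
      by (intro add_mono mult_mono norm_regular_le norm_slope_le C) auto
    also have "\<dots> = exp mass * (1 + mass / norm x) * C" by (simp add: algebra_simps)
    also have "\<dots> \<le> ?K * (1 + 1 / norm x)" by (rule Kmono) simp
    finally show "norm (grad i x) \<le> ?K * (1 + 1 / norm x)" .
  qed
qed

text \<open>Everything is deduced from the second weak derivatives on the whole ball. \<open>U\<close> and \<open>V0\<close> are allowed to
  differ from \<open>u\<close> and \<open>V\<close> on null sets, which covers the value of \<open>U\<close> at the origin and a potential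
  that is only Lebesgue measurable.\<close>

lemma solution_properties:
  fixes U :: "real^'n \<Rightarrow> complex" and V0 :: "real \<Rightarrow> complex"
  assumes U: "\<And>x. 0 < norm x \<Longrightarrow> norm x < 1 \<Longrightarrow> U x = u x"
    and V0: "AE r in lborel. r \<in> {0<..<1} \<longrightarrow> V r = V0 r"
  shows "U \<in> Sobolev 1 2 (ball 0 1)"
    and "0 < \<epsilon> \<Longrightarrow> U \<in> Sobolev 2 1 (annulus \<epsilon>)"
    and "0 < \<epsilon> \<Longrightarrow> \<exists>w. weak_laplacian (annulus \<epsilon>) U w
        \<and> (AE x in lebesgue_on (annulus \<epsilon>). - w x + V0 (norm x) * U x = 0)"
    and "U \<in> Sol_weak V0"
proof -
  have Uu: "AE x in lebesgue. x \<in> ball 0 1 \<longrightarrow> u x = U x"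
    by (rule AE_ball_punctured) (simp add: U)
  have VV: "AE x in lebesgue. x \<in> ball (0 :: real^'n) 1 \<and> x \<noteq> 0 \<longrightarrow> V (norm x) = V0 (norm x)"
    unfolding AE_completion_iff by (rule AE_radial_ball[OF V0])
  have N0: "AE x in (lebesgue :: (real^'n) measure). x \<noteq> 0"
    unfolding AE_completion_iff by (rule AE_lborel_singleton)
  have Lap: "AE x in lebesgue. x \<in> ball 0 1 \<longrightarrow> (\<Sum>i\<in>UNIV. hess i i x) = V0 (norm x) * U x"
    using VV N0 by eventually_elim (auto simp: trace_hess U)
  have WU1: "weak_deriv (ball 0 1) [i] U (grad i)" for i
    by (rule weak_deriv_spike[OF weak_deriv_u _ Uu]) auto
  have WU2: "weak_deriv (ball 0 1) [i, j] U (hess i j)" for i j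
    by (rule weak_deriv_trans[OF WU1 weak_deriv_grad])
  have U_L2: "U \<in> Lp_space 2 (ball 0 1)"
    by (rule Lp_space_spike[OF u_L2 Uu]) simp
  have U_loc: "locally_integrable (ball 0 1) U" using WU1 by (auto simp: weak_deriv_def)
  show S: "U \<in> Sobolev 1 2 (ball 0 1)"
    by (rule SobolevI1[OF U_L2 U_loc WU1 grad_L2])
  show "U \<in> Sol_weak V0"
    unfolding Sol_weak_def
  proof (intro CollectI conjI S exI[of _ grad] allI ballI)
    fix \<phi> :: "real^'n \<Rightarrow> complex" assume \<phi>: "\<phi> \<in> test_functions (ball 0 1)"
    have h: "integrable (lebesgue_on (ball 0 1)) (\<lambda>x. hess i i x * \<phi> x)" for i
      by (rule integrable_mult_test_function[OF _ \<phi>]) 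
        (auto intro: integrable_imp_locally_integrable hess_integrable)
    have g: "integrable (lebesgue_on (ball 0 1)) (\<lambda>x. grad i x * partial i \<phi> x)" for i
      by (rule integrable_mult_test_function[OF _ test_function_partial[OF \<phi>]])
        (auto intro: integrable_imp_locally_integrable grad_integrable)
    have eq: "AE x in lebesgue. indicator (ball 0 1) x *\<^sub>R (\<Sum>i\<in>UNIV. hess i i x * \<phi> x)
        = indicator (ball 0 1) x *\<^sub>R (V0 (norm x) * U x * \<phi> x)"
      using Lap by eventually_elim (auto simp: indicator_def simp flip: sum_distrib_right)
    have hs: "integrable (lebesgue_on (ball 0 1)) (\<lambda>x. \<Sum>i\<in>UNIV. hess i i x * \<phi> x)"
      by (intro Bochner_Integration.integrable_sum h)
    show V: "integrable (lebesgue_on (ball 0 1)) (\<lambda>x. V0 (norm x) * U x * \<phi> x)"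
      using hs integrable_lebesgue_spike[OF eq] by (simp add: integral_lebesgue_on)
    have "(LINT x|lebesgue_on (ball 0 1). V0 (norm x) * U x * \<phi> x)
        = (LINT x|lebesgue_on (ball 0 1). (\<Sum>i\<in>UNIV. hess i i x * \<phi> x))"
      using integral_lebesgue_spike[OF eq] by (simp add: integral_lebesgue_on)
    also have "\<dots> = (\<Sum>i\<in>UNIV. LINT x|lebesgue_on (ball 0 1). hess i i x * \<phi> x)"
      by (rule Bochner_Integration.integral_sum) (rule h)
    also have "\<dots> = - (\<Sum>i\<in>UNIV. LINT x|lebesgue_on (ball 0 1). grad i x * partial i \<phi> x)"
      using weak_deriv_grad \<phi> by (simp add: weak_deriv_def partials_def sum_negf)
    also have "\<dots> = - (LINT x|lebesgue_on (ball 0 1). (\<Sum>i\<in>UNIV. grad i x * partial i \<phi> x))"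
      by (subst Bochner_Integration.integral_sum) (auto intro: g)
    finally show "(LINT x|lebesgue_on (ball 0 1).
        (\<Sum>i\<in>UNIV. grad i x * partial i \<phi> x) + V0 (norm x) * U x * \<phi> x) = 0"
      by (subst Bochner_Integration.integral_add) (auto intro!: V Bochner_Integration.integrable_sum g)
  qed (rule WU1)
  assume \<epsilon>: "0 < \<epsilon>"
  let ?A = "annulus \<epsilon> :: (real^'n) set"
  have "open ?A"
    unfolding annulus_def by (intro open_Collect_conj open_Collect_less continuous_intros)
  then have A: "?A \<in> sets lebesgue" "?A \<subseteq> ball 0 1" by (auto simp: annulus_def)
  note mono = weak_deriv_mono[OF _ A(2) _ A(1)]
  have L1: "k \<in> Lp_space 1 ?A" if "integrable (lebesgue_on (ball 0 1)) k" for k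
    by (rule Lp_space_1, rule integrable_lebesgue_on_subset[OF that _ A]) simp
  have W1: "weak_deriv ?A [i] U (grad i)" and W2: "weak_deriv ?A [i, j] U (hess i j)" for i j
    by (rule mono[OF WU1], simp, rule mono[OF WU2], simp)
  have "u \<in> Lp_space 1 ?A" by (rule L1[OF u_integrable])
  then have UL: "U \<in> Lp_space 1 ?A"
    by (rule Lp_space_spike) (use Uu A in \<open>auto elim!: eventually_mono\<close>)
  show "U \<in> Sobolev 2 1 ?A"
    using W1 by (intro SobolevI2[OF UL _ W1 _ W2] L1 grad_integrable hess_integrable) (auto simp: weak_deriv_def)
  show "\<exists>w. weak_laplacian ?A U w \<and> (AE x in lebesgue_on ?A. - w x + V0 (norm x) * U x = 0)"
  proof (intro exI conjI)
    show "weak_laplacian ?A U (\<lambda>x. \<Sum>i\<in>UNIV. hess i i x)"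
      unfolding weak_laplacian_def using W2 by (intro exI[of _ "\<lambda>i. hess i i"]) auto
    have "AE x in lebesgue. x \<in> ?A \<longrightarrow> - (\<Sum>i\<in>UNIV. hess i i x) + V0 (norm x) * U x = 0"
      using Lap by eventually_elim (use A(2) in auto)
    then show "AE x in lebesgue_on ?A. - (\<Sum>i\<in>UNIV. hess i i x) + V0 (norm x) * U x = 0"
      using A(1) by (simp add: AE_restrict_space_iff)
  qed
qed

end

section \<open>The series for the regular solution and the conclusion\<close>

lemma borel_version_complex:
  fixes f :: "real \<Rightarrow> complex"
  assumes "f \<in> borel_measurable lebesgue"
  obtains g where "g \<in> borel_measurable borel" "AE x in lborel. f x = g x"
proof -
  have "(\<lambda>x. Re (f x)) \<in> borel_measurable lebesgue" "(\<lambda>x. Im (f x)) \<in> borel_measurable lebesgue"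
    using assms by auto
  then obtain a b where [measurable]: "a \<in> borel_measurable lborel" "b \<in> borel_measurable lborel"
    and ab: "AE x in lborel. Re (f x) = a x" "AE x in lborel. Im (f x) = b x"
    using completion_ex_borel_measurable_real by metis
  have "(\<lambda>x. Complex (a x) (b x)) \<in> borel_measurable borel"
    unfolding Complex_eq by measurable
  moreover have "AE x in lborel. f x = Complex (a x) (b x)"
    using ab by eventually_elim (simp add: complex_eq_iff)
  ultimately show thesis by (rule that)
qed

text \<open>The values of a potential on a null set do not affect the integrals in the recursion, so \<open>V0\<close> may be
  any function that agrees with \<open>V\<close> almost everywhere on the unit interval.\<close>

lemma (in radial_potential) psi_eq_series_term:
  fixes V0 :: "real \<Rightarrow> complex"
  assumes V0: "AE r in lborel. r \<in> {0<..<1} \<longrightarrow> V r = V0 r"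
    and l: "2 * l + 1 = real N" and r: "0 < r" "r < 1"
  shows "psi V0 l k r = of_real (r powr (l + 1)) * series_term k r"
  using r
proof (induction k arbitrary: r)
  case (Suc k)
  note r = Suc.prems
  let ?f = "\<lambda>s. of_real (1 / (2 * l + 1) * (r powr (l + 1) / s powr l - s powr (l + 1) / r powr l))
          * V0 s * psi V0 l k s"
  have pw: "x powr (l + 1) * x powr l = x ^ N" if "0 < x" for x :: real
  proof -
    have "x powr (l + 1) * x powr l = x powr (real N)" using l by (simp flip: powr_add add: algebra_simps)
    then show ?thesis using that by (simp add: powr_realpow)
  qed
  have ker: "(1 / (2 * l + 1) * (r powr (l + 1) / s powr l - s powr (l + 1) / r powr l)) * s powr (l + 1)
      = r powr (l + 1) * kernel r s" if s: "0 < s" "s < r" for s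
  proof -
    have a: "s powr (l + 1) = s * s powr l" "r powr (l + 1) = r * r powr l"
      using s r by (simp_all add: powr_add)
    have b: "s ^ N = s * s powr l * s powr l" "r ^ N = r * r powr l * r powr l"
      using pw[of s] pw[of r] s r by (simp_all add: a)
    have nz: "s powr l \<noteq> 0" "r powr l \<noteq> 0" "real N \<noteq> 0" using s r N_pos by auto
    \<comment> \<open>\<open>R\<close> and \<open>S\<close> stand for the powers of \<open>r\<close> and \<open>s\<close> with exponent \<open>l\<close>\<close>
    have alg: "(1 / n * (r * R / S - s * S / R)) * (s * S) = r * R * (s * (1 - s * S * S / (r * R * R)) / n)"
      if "R \<noteq> 0" "S \<noteq> 0" "n \<noteq> 0" "r \<noteq> 0" for R S n r s :: real
      using that by (simp add: divide_simps)
    have "kernel r s = s * (1 - (s / r) ^ N) / N" using s by (simp add: kernel_def)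
    also have "\<dots> = s * (1 - s * s powr l * s powr l / (r * r powr l * r powr l)) / N"
      unfolding power_divide b ..
    finally have ker: "kernel r s = s * (1 - s * s powr l * s powr l / (r * r powr l * r powr l)) / N" .
    show ?thesis unfolding ker l a by (rule alg) (use nz r in auto)
  qed
  have "psi V0 l (Suc k) r = (\<integral>s. indicator {0<..<r} s *\<^sub>R ?f s \<partial>lebesgue)"
    unfolding psi.simps by (rule integral_lebesgue_on(1)) simp
  also have "\<dots> = (\<integral>s. of_real (r powr (l + 1)) * (of_real (kernel r s) * V s * series_term k s) \<partial>lebesgue)"
  proof (rule integral_lebesgue_spike)
    have "AE s in lebesgue. s \<in> {0<..<1} \<longrightarrow> V s = V0 s"
      using V0 by (simp only: AE_completion_iff)
    then show "AE s in lebesgue. indicator {0<..<r} s *\<^sub>R ?f s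
        = of_real (r powr (l + 1)) * (of_real (kernel r s) * V s * series_term k s)"
    proof eventually_elim
      fix s assume VV: "s \<in> {0<..<1} \<longrightarrow> V s = V0 s"
      show "indicator {0<..<r} s *\<^sub>R ?f s
        = of_real (r powr (l + 1)) * (of_real (kernel r s) * V s * series_term k s)"
      proof (cases "s \<in> {0<..<r}")
        case True
        then have s: "0 < s" "s < r" "s < 1" using r by auto
        have assoc: "of_real a * v * (of_real c * t) = of_real (a * c) * v * t" for a c :: real and v t :: complex
          by simp
        have "?f s = of_real ((1 / (2 * l + 1) * (r powr (l + 1) / s powr l - s powr (l + 1) / r powr l)) * s powr (l + 1))
            * V s * series_term k s"
          unfolding Suc.IH[OF s(1,3)] assoc using VV s by simp
        then show ?thesis unfolding ker[OF s(1,2)] using True by simp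
      next
        case False
        then show ?thesis by (auto simp: kernel_def)
      qed
    qed
  qed
  also have "\<dots> = of_real (r powr (l + 1)) * (\<integral>s. of_real (kernel r s) * V s * series_term k s \<partial>lborel)"
    by (subst integral_completion) simp_all
  finally show ?case by simp
qed simp

lemma (in radial_potential) alpha_eq_regular:
  fixes V0 :: "real \<Rightarrow> complex"
  assumes V0: "AE r in lborel. r \<in> {0<..<1} \<longrightarrow> V r = V0 r"
    and l: "2 * ell d m + 1 = real N" and r: "0 < r" "r < 1"
  shows "alpha V0 d m r = regular r"
proof -
  have "y_reg V0 d m r = of_real (r powr (ell d m + 1)) * regular r"
    unfolding y_reg_def regular_def psi_eq_series_term[OF V0 l r]
    by (rule suminf_mult[OF summable_series_term(2)])
  then show ?thesis using r by (simp add: alpha_def)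
qed

theorem theorem9:
  fixes V :: "real \<Rightarrow> complex" and m :: nat and p :: "real^'n::finite \<Rightarrow> complex"
  assumes "CARD('n) \<ge> 3"
    and "V \<in> borel_measurable (lebesgue_on {0<..<1})"
    and "integrable (lebesgue_on {0<..<1}) (\<lambda>r. r * norm (V r))"
    and "p \<in> spherical_harmonics m"
  shows "U_sol V m p \<in> Sobolev 1 2 (ball 0 1)
    \<and> (\<forall>\<epsilon>. 0 < \<epsilon> \<and> \<epsilon> < 1 \<longrightarrow>
         U_sol V m p \<in> Sobolev 2 1 (annulus \<epsilon>) \<and>
         (\<exists>w. weak_laplacian (annulus \<epsilon>) (U_sol V m p) w \<and>
            (AE x in lebesgue_on (annulus \<epsilon>). - w x + V (norm x) * U_sol V m p x = 0)))
    \<and> U_sol V m p \<in> Sol_weak V"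
proof -
  define I where "I = {0<..<1::real}"
  have "(\<lambda>r. indicator I r *\<^sub>R V r) \<in> borel_measurable lebesgue"
    using assms(2) by (subst (asm) borel_measurable_restrict_space_iff) (auto simp: I_def)
  then obtain B where B [measurable]: "B \<in> borel_measurable borel"
    and VB: "AE r in lborel. indicator I r *\<^sub>R V r = B r"
    by (rule borel_version_complex)
  define V' where "V' r = indicator I r *\<^sub>R B r" for r
  have V'_borel [measurable]: "V' \<in> borel_measurable borel"
    unfolding V'_def[abs_def] I_def by measurable
  have V'V: "AE r in lborel. r \<in> {0<..<1} \<longrightarrow> V' r = V r"
    using VB by eventually_elim (auto simp: V'_def I_def)
  have V'_int: "integrable lborel (\<lambda>r. r * norm (V' r))"
  proof -
    have "integrable lebesgue (\<lambda>r. indicator I r *\<^sub>R (r * norm (V r)))"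
      using assms(3) by (simp add: integral_lebesgue_on I_def)
    then have "integrable lebesgue (\<lambda>r. r * norm (V' r))"
    proof (rule integrable_lebesgue_spike[rotated])
      have "AE r in lebesgue. r \<in> {0<..<1} \<longrightarrow> V' r = V r"
        using V'V by (simp only: AE_completion_iff)
      then show "AE r in lebesgue. indicator I r *\<^sub>R (r * norm (V r)) = r * norm (V' r)"
        by eventually_elim (auto simp: I_def V'_def split: split_indicator)
    qed
    then show ?thesis by (subst (asm) integrable_completion) simp_all
  qed
  obtain P where P: "homogeneous_polynomial m P" "harmonic P" "\<And>\<xi>. \<xi> \<in> sphere 0 1 \<Longrightarrow> p \<xi> = P \<xi>"
    using assms(4) by (auto simp: spherical_harmonics_def)
  define N where "N = 2 * m + CARD('n) - 2"
  interpret separated_solution V' N P m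
    by unfold_locales (use assms(1) V'_int P in \<open>auto simp: N_def V'_def I_def\<close>)
  have l: "2 * ell CARD('n) m + 1 = real N"
    using assms(1) by (simp add: ell_def N_def of_nat_diff field_simps)
  have U: "U_sol V m p x = u x" if x: "0 < norm x" "norm x < 1" for x
  proof -
    have "P x = P (norm x *\<^sub>R (x /\<^sub>R norm x))" using x by simp
    also have "\<dots> = of_real (norm x ^ m) * p (x /\<^sub>R norm x)"
      using x by (subst homogeneous_polynomial_scale[OF P(1)]) (simp add: P(3))
    finally show ?thesis
      unfolding U_sol_def u_def alpha_eq_regular[OF V'V l x] by (simp add: ac_simps)
  qed
  show ?thesis using solution_properties[OF U V'V] by blast
qed


end
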